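(* For every function $f:\mathbb{N}\to\mathbb{R}$ with $f(n)\to\infty$ as $n\to\infty$, there exist an irrational $\alpha\in(0,1)$ and an increasing sequence of positive integers $\{n_t\}_{t=1}^\infty$ such that, if $\mathbf{G}^1_{n_t},\mathbf{G}^2_{n_t}$ are independent samples of $G(n_t,n_t^{-\alpha})$, then with probability tending to $1$ as $t\to\infty$ we have $k(\mathbf{G}^1_{n_t},\mathbf{G}^2_{n_t})\le f(n_t)$.
   Context: Graphs are finite simple graphs; the first order (FO) language of graphs has the adjacency and equality relations. A FO sentence $\varphi$ distinguishes graphs $G_1,G_2$ if exactly one of them satisfies $\varphi$. The FO distinguishability $k(G_1,G_2)$ is the minimum quantifier depth of a FO sentence distinguishing $G_1$ and $G_2$. $G(n,p)$ is the random graph on $[n]$ in which each pair is an edge independently with probability $p$. *)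

theory Defs
  imports "HOL-Probability.Probability"
begin

record 'a graph =
  verts :: "'a set"
  edges :: "'a set set"

definition vertex_pairs :: "'a set \<Rightarrow> 'a set set" where
  "vertex_pairs V = {e. e \<subseteq> V \<and> card e = 2}"

definition simple_graph :: "'a graph \<Rightarrow> bool" where
  "simple_graph G \<longleftrightarrow> finite (verts G) \<and> edges G \<subseteq> vertex_pairs (verts G)"

definition adjacent :: "'a graph \<Rightarrow> 'a \<Rightarrow> 'a \<Rightarrow> bool" where
  "adjacent G x y \<longleftrightarrow> {x, y} \<in> edges G"

datatype fo =
    Adj nat nat
  | Eq nat nat
  | Neg fo
  | Conj fo fo
  | Disj fo fo
  | Exists nat fo
  | Forall nat fo

primrec free_vars :: "fo \<Rightarrow> nat set" where
  "free_vars (Adj i j) = {i, j}"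
| "free_vars (Eq i j) = {i, j}"
| "free_vars (Neg \<phi>) = free_vars \<phi>"
| "free_vars (Conj \<phi> \<psi>) = free_vars \<phi> \<union> free_vars \<psi>"
| "free_vars (Disj \<phi> \<psi>) = free_vars \<phi> \<union> free_vars \<psi>"
| "free_vars (Exists i \<phi>) = free_vars \<phi> - {i}"
| "free_vars (Forall i \<phi>) = free_vars \<phi> - {i}"

definition sentence :: "fo \<Rightarrow> bool" where
  "sentence \<phi> \<longleftrightarrow> free_vars \<phi> = {}"

primrec quantifier_depth :: "fo \<Rightarrow> nat" where
  "quantifier_depth (Adj i j) = 0"
| "quantifier_depth (Eq i j) = 0"
| "quantifier_depth (Neg \<phi>) = quantifier_depth \<phi>"
| "quantifier_depth (Conj \<phi> \<psi>) = max (quantifier_depth \<phi>) (quantifier_depth \<psi>)"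
| "quantifier_depth (Disj \<phi> \<psi>) = max (quantifier_depth \<phi>) (quantifier_depth \<psi>)"
| "quantifier_depth (Exists i \<phi>) = Suc (quantifier_depth \<phi>)"
| "quantifier_depth (Forall i \<phi>) = Suc (quantifier_depth \<phi>)"

primrec sat :: "'a graph \<Rightarrow> (nat \<Rightarrow> 'a) \<Rightarrow> fo \<Rightarrow> bool" where
  "sat G v (Adj i j) \<longleftrightarrow> adjacent G (v i) (v j)"
| "sat G v (Eq i j) \<longleftrightarrow> v i = v j"
| "sat G v (Neg \<phi>) \<longleftrightarrow> \<not> sat G v \<phi>"
| "sat G v (Conj \<phi> \<psi>) \<longleftrightarrow> sat G v \<phi> \<and> sat G v \<psi>"
| "sat G v (Disj \<phi> \<psi>) \<longleftrightarrow> sat G v \<phi> \<or> sat G v \<psi>"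
| "sat G v (Exists i \<phi>) \<longleftrightarrow> (\<exists>x\<in>verts G. sat G (v(i := x)) \<phi>)"
| "sat G v (Forall i \<phi>) \<longleftrightarrow> (\<forall>x\<in>verts G. sat G (v(i := x)) \<phi>)"

lemma sat_cong_free_vars:
  "(\<And>i. i \<in> free_vars \<phi> \<Longrightarrow> v i = w i) \<Longrightarrow> sat G v \<phi> \<longleftrightarrow> sat G w \<phi>"
proof (induction \<phi> arbitrary: v w)
  case (Neg \<phi>)
  then show ?case by (metis free_vars.simps(3) sat.simps(3))
next
  case (Conj \<phi> \<psi>)
  then show ?case by (metis UnCI free_vars.simps(4) sat.simps(4))
next
  case (Disj \<phi> \<psi>)
  then show ?case by (metis UnCI free_vars.simps(5) sat.simps(5))
next
  case (Exists i \<phi>)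
  have "sat G (v(i := x)) \<phi> \<longleftrightarrow> sat G (w(i := x)) \<phi>" for x
    by (rule Exists.IH) (use Exists.prems in auto)
  then show ?case by simp
next
  case (Forall i \<phi>)
  have "sat G (v(i := x)) \<phi> \<longleftrightarrow> sat G (w(i := x)) \<phi>" for x
    by (rule Forall.IH) (use Forall.prems in auto)
  then show ?case by simp
qed simp_all

text \<open>The truth value of a sentence does not depend on the valuation (\<open>sat_sentence\<close>
  below), so quantifying over all valuations is only a canonical way to discard it. Valuations are
  not confined to \<open>verts G\<close>, so the definition is also correct for the empty graph.\<close>

definition models :: "'a graph \<Rightarrow> fo \<Rightarrow> bool" where
  "models G \<phi> \<longleftrightarrow> (\<forall>v. sat G v \<phi>)"

lemma sat_sentence: "sentence \<phi> \<Longrightarrow> sat G v \<phi> \<longleftrightarrow> models G \<phi>"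
  unfolding models_def sentence_def using sat_cong_free_vars[of \<phi>] by blast

definition distinguishes :: "fo \<Rightarrow> 'a graph \<Rightarrow> 'b graph \<Rightarrow> bool" where
  "distinguishes \<phi> G\<^sub>1 G\<^sub>2 \<longleftrightarrow> models G\<^sub>1 \<phi> \<noteq> models G\<^sub>2 \<phi>"

text \<open>The minimum over the empty set, i.e. for isomorphic finite graphs, is \<open>\<infinity>\<close>.\<close>

definition fo_distinguishability :: "'a graph \<Rightarrow> 'b graph \<Rightarrow> enat" where
  "fo_distinguishability G\<^sub>1 G\<^sub>2 =
     Inf {enat (quantifier_depth \<phi>) | \<phi>. sentence \<phi> \<and> distinguishes \<phi> G\<^sub>1 G\<^sub>2}"

text \<open>\<open>bernoulli_pmf\<close> truncates its parameter to the unit interval, so only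
  \<open>0 \<le> p \<le> 1\<close> is meaningful.\<close>

definition random_graph :: "nat \<Rightarrow> real \<Rightarrow> nat graph pmf" where
  "random_graph n p =
     map_pmf (\<lambda>\<omega>. \<lparr>verts = {1..n}, edges = {e \<in> vertex_pairs {1..n}. \<omega> e}\<rparr>)
       (Pi_pmf (vertex_pairs {1..n}) False (\<lambda>_. bernoulli_pmf p))"

lemma simple_graph_random_graph: "G \<in> set_pmf (random_graph n p) \<Longrightarrow> simple_graph G"
  by (auto simp: random_graph_def simple_graph_def)

end

theory Submission
  imports Defs
begin

text \<open>
  For fixed \<open>n\<close> the probability of any event is continuous in \<open>\<alpha>\<close>, so by Baire's theorem it
  suffices to find, in every subinterval of \<open>(4/5, 1)\<close> and for every \<open>\<epsilon> > 0\<close>, a constant \<open>k\<close> such that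
  for all large \<open>n\<close> some \<open>\<alpha>\<close> in the subinterval makes two samples distinguishable in depth \<open>k\<close>
  with probability at least \<open>1 - \<epsilon>\<close>.

  Pick a strictly balanced graph \<open>F\<close> with \<open>v\<close> vertices and \<open>e\<close> edges, \<open>v / e\<close> in the subinterval, and
  let \<open>p\<close> make the expected number of copies of \<open>F\<close> equal to a large constant \<open>\<mu>\<close>. The number of
  copies is then nearly Poisson, so two independent counts agree with probability \<open>O(1 / \<surd>\<mu>)\<close>, and
  counts up to a constant are visible in bounded quantifier depth. Only the local Stein identity
  \<open>(m + 1) P(X = m + 1) \<approx> \<mu> P(X = m)\<close> is needed, not Poisson convergence.

  To get \<open>F\<close>, take a graph of large girth and density at least \<open>5/4\<close>: a subgraph that is minimal among
  those of density above \<open>c\<close> is strictly balanced, and large girth forces its density to be close to \<open>c\<close>.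
\<close>

text \<open>For a fixed irrational \<open>\<alpha>\<close> every fixed sentence has limiting
  probability 0 or 1 (Shelah and Spencer), so no bounded depth separates two samples with
  probability tending to 1. The depth has to grow, and \<open>\<alpha>\<close> has to be adapted to
  \<open>f\<close>, however slowly \<open>f\<close> grows. Category does this: near
  \<open>v / e\<close> there is for each large \<open>n\<close> an exponent, depending on
  \<open>n\<close>, at which the mean count is exactly \<open>\<mu>\<close>. One \<open>n\<close>
  with \<open>f n\<close> above the depth \<open>k\<close> is enough, since continuity keeps the
  success probability on a neighbourhood. A generic \<open>\<alpha>\<close> meets such
  neighbourhoods for infinitely many \<open>n\<close>.

  The number 5/4 comes from graphs of maximum degree 3 in which at most a sixth of the vertices have
  smaller degree. Its reciprocal 4/5 is the left end of the interval of exponents. The right end 1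
  reflects that densities must be at least 1 for large girth to have an effect.\<close>

section \<open>Strictly balanced graphs of prescribed density\<close>

text \<open>This encodes girth at least \<open>g\<close>: a cycle has as many edges as vertices,
  whereas a nonempty forest has fewer. In this form the condition can be combined directly with edge
  and vertex counts, without speaking of cycles.\<close>

definition locally_sparse :: "nat \<Rightarrow> 'a set set \<Rightarrow> bool" where
  "locally_sparse g E \<longleftrightarrow>
     (\<forall>F\<subseteq>E. F \<noteq> {} \<longrightarrow> card (\<Union>F) < g \<longrightarrow> card F < card (\<Union>F))"

section \<open>Walks along edges and balls around a vertex\<close>

definition adj_rel :: "'a set set \<Rightarrow> ('a \<times> 'a) set" where
  "adj_rel E = {(a, b). {a, b} \<in> E}"

lemma finite_adj_rel:
  assumes "finite E" "\<forall>e\<in>E. finite e"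
  shows "finite (adj_rel E)"
proof (rule finite_subset)
  show "adj_rel E \<subseteq> \<Union>E \<times> \<Union>E" by (auto simp: adj_rel_def)
  show "finite (\<Union>E \<times> \<Union>E)" using assms by blast
qed

lemma card_adj_rel_Image:
  assumes "finite E" "card {e \<in> E. z \<in> e} \<le> d"
  shows "finite (adj_rel E `` {z})" "card (adj_rel E `` {z}) \<le> d"
proof -
  have inj: "inj_on (\<lambda>b. {z, b}) (adj_rel E `` {z})" by (auto simp: inj_on_def doubleton_eq_iff)
  have sub: "(\<lambda>b. {z, b}) ` (adj_rel E `` {z}) \<subseteq> {e \<in> E. z \<in> e}" by (auto simp: adj_rel_def)
  have fin: "finite {e \<in> E. z \<in> e}" using assms by simp
  show "finite (adj_rel E `` {z})" using inj sub fin by (meson finite_imageD finite_subset)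
  show "card (adj_rel E `` {z}) \<le> d"
    using card_inj_on_le[OF inj sub fin] assms(2) by simp
qed

text \<open>Each step multiplies the number of endpoints by at most \<open>d\<close>. Summed over
  the lengths, this bounds the ball around a vertex that a new edge from this vertex has to
  leave.\<close>

lemma card_relpow_adj_rel_Image:
  assumes "finite E" "\<And>z. card {e \<in> E. z \<in> e} \<le> d"
  shows "finite ((adj_rel E ^^ n) `` {x}) \<and> card ((adj_rel E ^^ n) `` {x}) \<le> d ^ n"
proof (induction n)
  case (Suc n)
  let ?A = "(adj_rel E ^^ n) `` {x}"
  have eq: "(adj_rel E ^^ Suc n) `` {x} = (\<Union>z\<in>?A. adj_rel E `` {z})" by auto
  have "card (\<Union>z\<in>?A. adj_rel E `` {z}) \<le> (\<Sum>z\<in>?A. card (adj_rel E `` {z}))"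
    using Suc by (intro card_UN_le) auto
  also have "\<dots> \<le> (\<Sum>z\<in>?A. d)"
    using card_adj_rel_Image(2)[OF assms(1) assms(2)] by (intro sum_mono) auto
  also have "\<dots> \<le> d ^ Suc n" using Suc by simp
  finally show ?case
    unfolding eq using Suc card_adj_rel_Image(1)[OF assms(1) assms(2)] by auto
qed simp

lemma adj_rel_mono: "F \<subseteq> E \<Longrightarrow> adj_rel F \<subseteq> adj_rel E"
  by (auto simp: adj_rel_def)

text \<open>Every edge carries two ordered pairs. This is the source of the factor in the walk
  length \<open>2 * g\<close> below, where a connecting walk is first bounded by the number of pairs
  in the relation.\<close>

lemma card_adj_rel_le:
  assumes "finite F" "\<forall>e\<in>F. card e = 2"
  shows "card (adj_rel F) \<le> 2 * card F"
proof -
  have "adj_rel F = (\<Union>e\<in>F. {(a, b). {a, b} = e})" by (auto simp: adj_rel_def)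
  then have "card (adj_rel F) \<le> (\<Sum>e\<in>F. card {(a, b). {a, b} = e})"
    using assms by (simp add: card_UN_le)
  also have "\<dots> \<le> (\<Sum>e\<in>F. 2)"
  proof (rule sum_mono)
    fix e assume "e \<in> F"
    then obtain a b where e: "e = {a, b}" using assms by (auto simp: card_2_iff)
    have "{(x, y). {x, y} = e} \<subseteq> {(a, b), (b, a)}"
    proof
      fix q assume "q \<in> {(x, y). {x, y} = e}"
      then obtain x y where q: "q = (x, y)" "{x, y} = {a, b}" unfolding e by blast
      from q(2) show "q \<in> {(a, b), (b, a)}" unfolding q(1) doubleton_eq_iff by blast
    qed
    then have "card {(x, y). {x, y} = e} \<le> card {(a, b), (b, a)}" by (intro card_mono) simp_all
    also have "\<dots> \<le> 2" by (rule card_insert_le_m1) simp_all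
    finally show "card {(x, y). {x, y} = e} \<le> 2" .
  qed
  finally show ?thesis by simp
qed

lemma relpow_subset_mono:
  fixes R S :: "('a \<times> 'a) set"
  shows "R \<subseteq> S \<Longrightarrow> R ^^ n \<subseteq> S ^^ n"
  by (induction n) auto

text \<open>A violating edge set \<open>F\<close> contains the new edge; let \<open>F0\<close> be
  the rest. If \<open>F0\<close> connects \<open>x\<close> to \<open>y\<close>, some walk of length
  at most \<open>2 * card F0\<close> contradicts the distance hypothesis. Otherwise the component
  \<open>A\<close> of \<open>x\<close> cuts \<open>F0\<close> into two pieces, each with fewer edges
  than vertices, and this surplus of two pays for the new edge with one to spare.\<close>

lemma locally_sparse_insert:
  assumes sparse: "locally_sparse g E" and "finite E" and two: "\<forall>e\<in>E. card e = 2"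
    and far: "\<And>n. n \<le> 2 * g \<Longrightarrow> (x, y) \<notin> adj_rel E ^^ n"
  shows "locally_sparse g (insert {x, y} E)"
  unfolding locally_sparse_def
proof (intro allI impI, rule ccontr)
  fix F assume F: "F \<subseteq> insert {x, y} E" "F \<noteq> {}" "card (\<Union>F) < g" "\<not> card F < card (\<Union>F)"
  have "\<not> F \<subseteq> E" using F sparse by (auto simp: locally_sparse_def)
  then have xyF: "{x, y} \<in> F" and nE: "{x, y} \<notin> E" using F(1) by auto
  define F0 where "F0 = F - {{x, y}}"
  define W where "W = \<Union>F"
  have F0E: "F0 \<subseteq> E" using F by (auto simp: F0_def)
  have finF0: "finite F0" using F0E \<open>finite E\<close> finite_subset by blast
  have finF: "finite F" using finF0 by (simp add: F0_def)
  have fe: "finite e" if "e \<in> F" for e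
  proof (cases "e = {x, y}")
    case False
    then have "card e = 2" using that F(1) two by auto
    then show ?thesis by (metis card.infinite zero_neq_numeral)
  qed simp
  have finW: "finite W" using fe finF by (auto simp: W_def)
  have W: "x \<in> W" "y \<in> W" using xyF by (auto simp: W_def)
  have cF0: "card F = Suc (card F0)" using xyF finF unfolding F0_def by (metis card.remove)
  \<comment> \<open>\<open>B\<close> may contain vertices outside \<open>K\<close>, and
    \<open>K\<close> may be empty. Local sparsity is silent about the empty edge set, where a
    nonempty \<open>B\<close> is enough.\<close>
  have small: "card K < card B" if "K \<subseteq> F0" "\<Union>K \<subseteq> B" "B \<subseteq> W" "B \<noteq> {}" for K B
  proof (cases "K = {}")
    case True
    have "finite B" using that finW finite_subset by blast
    then show ?thesis using True that by (simp add: card_gt_0_iff)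
  next
    case False
    have "finite B" using that finW finite_subset by blast
    then have le: "card (\<Union>K) \<le> card B" using that by (simp add: card_mono)
    have "card B \<le> card W" using that finW by (simp add: card_mono)
    then have "card (\<Union>K) < g" using le F(3) by (simp add: W_def)
    then have "card K < card (\<Union>K)"
      using sparse False that F0E unfolding locally_sparse_def by (meson order_trans)
    then show ?thesis using le by simp
  qed
  have twoF0: "\<forall>e\<in>F0. card e = 2" using two F0E by auto
  define A where "A = {z. (x, z) \<in> (adj_rel F0)\<^sup>*}"
  show False
  proof (cases "y \<in> A")
    case True
    have "finite (adj_rel F0)" using finite_adj_rel finF0 fe by (metis DiffD1 F0_def)
    then obtain n where n: "n \<le> card (adj_rel F0)" "(x, y) \<in> adj_rel F0 ^^ n"
      using True rtrancl_finite_eq_relpow[of "adj_rel F0"] by (auto simp: A_def)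
    have "card F0 < card W" using small[of F0 W] W by (auto simp: W_def F0_def)
    then have "n \<le> 2 * g"
      using n(1) card_adj_rel_le[OF finF0 twoF0] F(3) by (simp add: W_def)
    moreover have "(x, y) \<in> adj_rel E ^^ n"
      using n(2) relpow_subset_mono[OF adj_rel_mono[OF F0E], of n] by auto
    ultimately show False using far by blast
  next
    case False
    define F1 where "F1 = {e \<in> F0. e \<subseteq> A}"
    have step: "b \<in> A" if "{a, b} \<in> F0" "a \<in> A" for a b
      using that by (auto simp: A_def adj_rel_def intro: rtrancl_into_rtrancl)
    have sep: "e \<subseteq> A \<or> e \<inter> A = {}" if e: "e \<in> F0" for e
    proof -
      obtain a b where "e = {a, b}" using twoF0 e by (auto simp: card_2_iff)
      then show ?thesis using step e by (auto simp: insert_commute)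
    qed
    have xA: "x \<in> A" by (simp add: A_def)
    have "card F1 < card (W \<inter> A)"
      by (rule small) (use W xA in \<open>auto simp: F1_def W_def F0_def\<close>)
    moreover have "card (F0 - F1) < card (W - A)"
      by (rule small) (use W False sep in \<open>auto simp: F1_def W_def F0_def\<close>)
    moreover have "card F0 = card F1 + card (F0 - F1)"
      using finF0 card_Int_Diff[of F0 F1] by (simp add: F1_def Int_absorb1 subset_iff)
    moreover have "card W = card (W \<inter> A) + card (W - A)"
      using finW by (metis card_Int_Diff)
    ultimately show False using F(4) cF0 by (simp add: W_def)
  qed
qed

text \<open>Among the sparse graphs of maximum degree 3 on \<open>N\<close> vertices choose one with
  most edges. Two vertices of degree at most 2 are close to each other, since otherwise the edge
  between them could be added; so they all lie in one ball, of at most \<open>C\<close> vertices.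
  With \<open>N = 6 * C\<close> at least \<open>5 * C\<close> vertices have degree 3, hence
  \<open>15 * C \<le> 2 * card E\<close>, which is density 5/4 on \<open>6 * C\<close>
  vertices.\<close>

lemma exists_locally_sparse_dense:
  obtains E :: "nat set set" where "finite E" "E \<noteq> {}" "\<forall>e\<in>E. card e = 2"
    "locally_sparse g E" "5 * card (\<Union>E) \<le> 4 * card E"
proof -
  define C :: nat where "C = (\<Sum>n\<le>Suc (2 * g). 3 ^ n)"
  define N where "N = 6 * C"
  define good where "good E \<longleftrightarrow> E \<subseteq> vertex_pairs {..<N} \<and> locally_sparse g E
    \<and> (\<forall>z. card {e \<in> E. z \<in> e} \<le> 3)" for E :: "nat set set"
  have Cpos: "C > 0" unfolding C_def by (rule sum_pos) auto
  have "vertex_pairs {..<N} \<subseteq> Pow {..<N}" by (auto simp: vertex_pairs_def)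
  then have finP: "finite (vertex_pairs {..<N})" by (rule finite_subset) simp
  have "good {}" by (auto simp: good_def locally_sparse_def)
  moreover have "finite {E. good E}"
    by (rule finite_subset[of _ "Pow (vertex_pairs {..<N})"]) (use finP in \<open>auto simp: good_def\<close>)
  ultimately obtain E where E: "good E" and max: "\<And>E'. good E' \<Longrightarrow> card E' \<le> card E"
    using Max_in[of "card ` {E. good E}"] Max_ge[of "card ` {E. good E}"] by fastforce
  have finE: "finite E" using E finP finite_subset by (auto simp: good_def)
  have twoE: "\<forall>e\<in>E. card e = 2" using E by (auto simp: good_def vertex_pairs_def)
  have deg: "card {e \<in> E. z \<in> e} \<le> 3" for z using E by (auto simp: good_def)
  define L where "L = {z. z < N \<and> card {e \<in> E. z \<in> e} \<le> 2}"
  have cL: "card L \<le> C"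
  proof (rule ccontr)
    assume big: "\<not> card L \<le> C"
    then obtain x where x: "x \<in> L" by fastforce
    \<comment> \<open>The radius exceeds \<open>2 * g\<close> by one so that length 1 is covered
      even for \<open>g = 0\<close>. Lengths 0 and 1 give \<open>x \<noteq> y\<close> and
      \<open>{x, y} \<notin> E\<close>.\<close>
    define B where "B = (\<Union>n\<le>Suc (2 * g). (adj_rel E ^^ n) `` {x})"
    have "card B \<le> (\<Sum>n\<le>Suc (2 * g). card ((adj_rel E ^^ n) `` {x}))"
      unfolding B_def by (intro card_UN_le) auto
    also have "\<dots> \<le> C"
      unfolding C_def using card_relpow_adj_rel_Image[OF finE deg] by (intro sum_mono) auto
    finally have "card B < card L" using big by simp
    moreover have "finite B" unfolding B_def using card_relpow_adj_rel_Image[OF finE deg] by auto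
    ultimately obtain y where y: "y \<in> L" "y \<notin> B" by (metis card_mono not_le subsetI)
    have far: "(x, y) \<notin> adj_rel E ^^ n" if "n \<le> Suc (2 * g)" for n
      using that y by (auto simp: B_def)
    have xy: "x \<noteq> y" using far[of 0] by auto
    have "{x, y} \<notin> E"
    proof
      assume "{x, y} \<in> E"
      then have "(x, y) \<in> adj_rel E ^^ 1" by (simp add: adj_rel_def)
      then show False using far[of 1] by simp
    qed
    have "good (insert {x, y} E)"
      unfolding good_def
    proof (intro conjI allI)
      show "insert {x, y} E \<subseteq> vertex_pairs {..<N}"
        using E x y xy by (auto simp: good_def L_def vertex_pairs_def)
      show "locally_sparse g (insert {x, y} E)"
        using E finE twoE far by (intro locally_sparse_insert) (auto simp: good_def)
      show "card {e \<in> insert {x, y} E. z \<in> e} \<le> 3" for z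
      proof (cases "z \<in> {x, y}")
        case True
        have "{e \<in> insert {x, y} E. z \<in> e} = insert {x, y} {e \<in> E. z \<in> e}" using True by auto
        moreover have "card {e \<in> E. z \<in> e} \<le> 2" using True x y by (auto simp: L_def)
        ultimately show ?thesis using finE by (simp add: card_insert_if)
      next
        case False
        then have "{e \<in> insert {x, y} E. z \<in> e} = {e \<in> E. z \<in> e}" by auto
        then show ?thesis using deg by simp
      qed
    qed
    then show False using max[of "insert {x, y} E"] finE \<open>{x, y} \<notin> E\<close> by simp
  qed
  have "3 * (N - C) \<le> 3 * card ({..<N} - L)"
    using cL by (subst card_Diff_subset) (auto simp: L_def)
  also have "\<dots> = (\<Sum>z\<in>{..<N} - L. 3)" by simp
  also have "\<dots> \<le> (\<Sum>z\<in>{..<N} - L. card {e \<in> E. z \<in> e})"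
    by (intro sum_mono) (auto simp: L_def)
  also have "\<dots> \<le> (\<Sum>z<N. card {e \<in> E. z \<in> e})"
    by (intro sum_mono2) auto
  also have "\<dots> = 2 * card E"
  proof (rule sum_multicount)
    show "\<forall>e\<in>E. card {z \<in> {..<N}. z \<in> e} = 2"
    proof
      fix e assume "e \<in> E"
      then have "{z \<in> {..<N}. z \<in> e} = e" using E by (auto simp: good_def vertex_pairs_def)
      then show "card {z \<in> {..<N}. z \<in> e} = 2" using twoE \<open>e \<in> E\<close> by simp
    qed
  qed (use finE in auto)
  finally have main: "15 * C \<le> 2 * card E" by (simp add: N_def)
  have "card (\<Union>E) \<le> card {..<N}"
    using E by (intro card_mono) (auto simp: good_def vertex_pairs_def)
  then have "5 * card (\<Union>E) \<le> 4 * card E" using main by (simp add: N_def)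
  moreover have "E \<noteq> {}" using main Cpos by auto
  ultimately show thesis using that finE twoE E by (auto simp: good_def)
qed

text \<open>The comparison of densities, edges over vertices, is cross-multiplied to stay in the
  naturals. Vertex sets are unions of edges, so isolated vertices never occur.\<close>

definition strictly_balanced :: "'a set set \<Rightarrow> bool" where
  "strictly_balanced F \<longleftrightarrow> finite F \<and> F \<noteq> {} \<and> (\<forall>e\<in>F. card e = 2) \<and>
     (\<forall>K. K \<subset> F \<longrightarrow> K \<noteq> {} \<longrightarrow> card K * card (\<Union>F) < card F * card (\<Union>K))"

text \<open>For the upper bound on the density, deleting one edge from the minimal \<open>F\<close>
  leaves density at most \<open>c\<close>, so \<open>F\<close> has at most \<open>c * v + 1\<close>
  edges, where \<open>v\<close> is its number of vertices. This is below \<open>d * v\<close> once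
  \<open>v > 1 / (d - c)\<close>. Since \<open>1 \<le> c\<close>, \<open>F\<close> has more edges
  than vertices, which local sparsity permits only for \<open>v \<ge> g\<close>.\<close>

lemma exists_strictly_balanced:
  fixes c d :: real
  assumes "1 \<le> c" "c < d" "d \<le> 5 / 4"
  obtains F :: "nat set set" where "strictly_balanced F"
    "c * card (\<Union>F) < card F" "card F < d * card (\<Union>F)"
proof -
  obtain g :: nat where g: "1 / (d - c) < g" using reals_Archimedean2 by blast
  obtain E :: "nat set set" where E: "finite E" "E \<noteq> {}" "\<forall>e\<in>E. card e = 2"
    "locally_sparse g E" "5 * card (\<Union>E) \<le> 4 * card E"
    using exists_locally_sparse_dense by blast
  have pos: "0 < card (\<Union>K)" if "K \<subseteq> E" "K \<noteq> {}" for K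
  proof -
    have "finite e" if "e \<in> E" for e using that E(3) by (metis card.infinite zero_neq_numeral)
    then have "finite (\<Union>K)"
      using that E(1) finite_subset[of K E] by (intro finite_Union) auto
    moreover have "\<Union>K \<noteq> {}" using that E(3) by fastforce
    ultimately show ?thesis by (simp add: card_gt_0_iff)
  qed
  define P where "P K \<longleftrightarrow> K \<subseteq> E \<and> K \<noteq> {} \<and> c * card (\<Union>K) < card K" for K
  have "P E"
  proof -
    have "c * card (\<Union>E) < 5 / 4 * card (\<Union>E)"
      using pos[of E] E(2) assms by (intro mult_strict_right_mono) auto
    also have "\<dots> \<le> card E" using E(5) by linarith
    finally show ?thesis using E(2) by (simp add: P_def)
  qed
  then obtain F where F: "P F" and min: "\<And>K. P K \<Longrightarrow> card F \<le> card K"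
    using ex_has_least_nat[of P E card] by blast
  have finF: "finite F" using F E finite_subset by (auto simp: P_def)
  have sub: "card K \<le> c * card (\<Union>K)" if "K \<subset> F" "K \<noteq> {}" for K
  proof -
    have "\<not> P K" using min[of K] psubset_card_mono[OF finF that(1)] by auto
    then show ?thesis using that F by (auto simp: P_def)
  qed
  have posF: "0 < card (\<Union>F)" using F pos unfolding P_def by blast
  have "strictly_balanced F"
    unfolding strictly_balanced_def
  proof (intro conjI allI impI)
    fix K assume K: "K \<subset> F" "K \<noteq> {}"
    then have posK: "0 < card (\<Union>K)" using F pos[of K] unfolding P_def by blast
    have "real (card K) * real (card (\<Union>F)) \<le> c * card (\<Union>K) * card (\<Union>F)"
      using sub[OF K] by (intro mult_right_mono) auto
    also have "\<dots> = c * card (\<Union>F) * card (\<Union>K)" by simp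
    also have "\<dots> < real (card F) * real (card (\<Union>K))"
      using F posK by (intro mult_strict_right_mono) (auto simp: P_def)
    finally show "card K * card (\<Union>F) < card F * card (\<Union>K)"
      by (metis of_nat_less_iff of_nat_mult)
  next
    show "F \<noteq> {}" "\<forall>e\<in>F. card e = 2" using F E(3) unfolding P_def by blast+
  qed (rule finF)
  moreover have "card F < d * card (\<Union>F)"
  proof -
    obtain e where e: "e \<in> F" using F by (auto simp: P_def)
    have "c * card (\<Union>F) \<ge> card (\<Union>F)" using assms(1) by (simp add: mult_le_cancel_right1)
    then have ge: "card (\<Union>F) < card F" using F by (simp add: P_def)
    then have "g \<le> card (\<Union>F)" using F E(4) unfolding P_def locally_sparse_def
      by (meson less_asym not_le)
    then have "1 / (d - c) < card (\<Union>F)" using g by linarith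
    then have "1 < (d - c) * card (\<Union>F)" using assms by (simp add: field_simps)
    moreover have "card (F - {e}) \<le> c * card (\<Union>F)"
    proof (cases "F - {e} = {}")
      case False
      then have "card (F - {e}) \<le> c * card (\<Union>(F - {e}))" using e by (intro sub) auto
      also have "\<dots> \<le> c * card (\<Union>F)"
        using assms posF by (intro mult_left_mono) (auto intro!: card_mono card_ge_0_finite)
      finally show ?thesis .
    next
      case True
      then show ?thesis using assms by (metis card.empty mult_nonneg_nonneg of_nat_0 of_nat_0_le_iff order_trans zero_le_one)
    qed
    moreover have "card F = Suc (card (F - {e}))" using e finF by (metis card.remove)
    ultimately show ?thesis by (simp add: algebra_simps)
  qed
  ultimately show thesis using that F by (auto simp: P_def)
qed

section \<open>Definability of subgraph counts\<close>

text \<open>A copy is represented by its set of edges. Embeddings that differ by an automorphism of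
  \<open>F\<close> thus give the same copy, and copies need not be induced.\<close>

definition copies :: "'a set set \<Rightarrow> 'b set \<Rightarrow> 'b set set set" where
  "copies F V = {(`) \<sigma> ` F |\<sigma>. inj_on \<sigma> (\<Union>F) \<and> \<sigma> ` \<Union>F \<subseteq> V}"

definition count_copies :: "'a set set \<Rightarrow> 'b graph \<Rightarrow> nat" where
  "count_copies F G = card {S \<in> copies F (verts G). S \<subseteq> edges G}"

lemma copies_subset_Pow: "copies F V \<subseteq> Pow (Pow V)"
proof
  fix S assume "S \<in> copies F V"
  then obtain \<sigma> where \<sigma>: "S = (`) \<sigma> ` F" "\<sigma> ` \<Union>F \<subseteq> V" unfolding copies_def by blast
  have "\<sigma> ` e \<subseteq> V" if "e \<in> F" for e using \<sigma>(2) that by fast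
  then show "S \<in> Pow (Pow V)" by (simp add: \<sigma>(1) image_subset_iff)
qed

lemma finite_copies: "finite V \<Longrightarrow> finite (copies F V)"
  by (rule finite_subset[OF copies_subset_Pow]) simp

section \<open>Quantifier blocks and quantifier-free definability\<close>

primrec exists_upto :: "nat \<Rightarrow> fo \<Rightarrow> fo" where
  "exists_upto 0 \<phi> = \<phi>"
| "exists_upto (Suc k) \<phi> = Exists k (exists_upto k \<phi>)"

lemma quantifier_depth_exists_upto:
  "quantifier_depth (exists_upto k \<phi>) = k + quantifier_depth \<phi>"
  by (induction k) simp_all

lemma free_vars_exists_upto: "free_vars (exists_upto k \<phi>) = free_vars \<phi> - {..<k}"
proof (induction k)
  case (Suc k)
  have "{..<Suc k} = insert k {..<k}" by (rule lessThan_Suc)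
  then show ?case using Suc by (simp only: exists_upto.simps free_vars.simps) blast
qed simp

lemma sat_exists_upto:
  "sat G v (exists_upto k \<phi>) \<longleftrightarrow>
     (\<exists>w. (\<forall>i<k. w i \<in> verts G) \<and> (\<forall>i\<ge>k. w i = v i) \<and> sat G w \<phi>)"
proof (induction k arbitrary: v)
  case 0
  have "(\<forall>i. w i = v i) \<longleftrightarrow> w = v" for w by auto
  then show ?case by simp
next
  case (Suc k)
  show ?case (is "?L \<longleftrightarrow> ?R")
  proof
    assume ?L
    then obtain x w where "x \<in> verts G" "\<forall>i<k. w i \<in> verts G" "\<forall>i\<ge>k. w i = (v(k := x)) i" "sat G w \<phi>"
      using Suc by auto
    moreover from this have "w i \<in> verts G" if "i < Suc k" for i
      using that by (cases "i = k") auto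
    ultimately show ?R by (intro exI[of _ w]) auto
  next
    assume ?R
    then obtain w where w: "\<forall>i<Suc k. w i \<in> verts G" "\<forall>i\<ge>Suc k. w i = v i" "sat G w \<phi>" by auto
    have "\<forall>i\<ge>k. w i = (v(k := w k)) i" using w(2) by (simp add: Suc_le_eq)
    moreover have "\<forall>i<k. w i \<in> verts G" using w(1) by simp
    ultimately have "sat G (v(k := w k)) (exists_upto k \<phi>)"
      unfolding Suc using w(3) by blast
    then show ?L using w(1) by (auto intro: bexI[of _ "w k"])
  qed
qed

text \<open>Definability is treated through closure rules, so that the long condition on several
  copies never has to be spelled out as a formula. The bound \<open>k\<close> on the free variables
  is what allows \<open>exists_upto k\<close> to close the formula.\<close>

definition qf_definable :: "nat \<Rightarrow> ('a graph \<Rightarrow> (nat \<Rightarrow> 'a) \<Rightarrow> bool) \<Rightarrow> bool" where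
  "qf_definable k P \<longleftrightarrow> (\<exists>\<phi>. quantifier_depth \<phi> = 0 \<and> free_vars \<phi> \<subseteq> {..<k} \<and> (\<forall>G v. sat G v \<phi> \<longleftrightarrow> P G v))"

lemma qf_definable_adjacent:
  "i < k \<Longrightarrow> j < k \<Longrightarrow> qf_definable k (\<lambda>G v. adjacent G (v i) (v j))"
  unfolding qf_definable_def by (intro exI[of _ "Adj i j"]) auto

lemma qf_definable_eq: "i < k \<Longrightarrow> j < k \<Longrightarrow> qf_definable k (\<lambda>G v. v i = v j)"
  unfolding qf_definable_def by (intro exI[of _ "Eq i j"]) auto

lemma qf_definable_not:
  assumes "qf_definable k P"
  shows "qf_definable k (\<lambda>G v. \<not> P G v)"
proof -
  obtain \<phi> where "quantifier_depth \<phi> = 0" "free_vars \<phi> \<subseteq> {..<k}" "\<forall>G v. sat G v \<phi> \<longleftrightarrow> P G v"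
    using assms unfolding qf_definable_def by blast
  then show ?thesis unfolding qf_definable_def by (intro exI[of _ "Neg \<phi>"]) auto
qed

lemma qf_definable_conj:
  assumes "qf_definable k P" "qf_definable k Q"
  shows "qf_definable k (\<lambda>G v. P G v \<and> Q G v)"
proof -
  obtain \<phi> \<psi> where "quantifier_depth \<phi> = 0" "free_vars \<phi> \<subseteq> {..<k}" "\<forall>G v. sat G v \<phi> \<longleftrightarrow> P G v"
    "quantifier_depth \<psi> = 0" "free_vars \<psi> \<subseteq> {..<k}" "\<forall>G v. sat G v \<psi> \<longleftrightarrow> Q G v"
    using assms unfolding qf_definable_def by blast
  then show ?thesis unfolding qf_definable_def by (intro exI[of _ "Conj \<phi> \<psi>"]) auto
qed

lemma qf_definable_ball:
  assumes "finite A" "0 < k" "\<And>x. x \<in> A \<Longrightarrow> qf_definable k (P x)"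
  shows "qf_definable k (\<lambda>G v. \<forall>x\<in>A. P x G v)"
  using assms(1,3)
proof (induction A)
  case empty
  \<comment> \<open>The language has no constant for truth. The empty conjunction becomes the
    equation of variable 0 with itself, which requires \<open>0 < k\<close>.\<close>
  show ?case using qf_definable_eq[OF assms(2) assms(2)] by simp
next
  case (insert x A)
  then have "qf_definable k (\<lambda>G v. P x G v \<and> (\<forall>x\<in>A. P x G v))"
    by (intro qf_definable_conj) auto
  then show ?case by simp
qed

lemma qf_definable_bex:
  assumes "finite A" "0 < k" "\<And>x. x \<in> A \<Longrightarrow> qf_definable k (P x)"
  shows "qf_definable k (\<lambda>G v. \<exists>x\<in>A. P x G v)"
proof -
  have "qf_definable k (\<lambda>G v. \<not> (\<forall>x\<in>A. \<not> P x G v))"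
    using assms by (intro qf_definable_not qf_definable_ball)
  then show ?thesis by simp
qed

text \<open>Applied to sets of edges and then to single edges, this reduces distinctness of two
  copies to bounded quantifiers and atomic equations, as the closure rules demand.\<close>

lemma image_eq_image_iff:
  "f ` A = g ` B \<longleftrightarrow> (\<forall>x\<in>A. \<exists>y\<in>B. f x = g y) \<and> (\<forall>y\<in>B. \<exists>x\<in>A. f x = g y)"
proof -
  have "g y \<in> f ` A \<longleftrightarrow> (\<exists>x\<in>A. f x = g y)" for y
    unfolding image_iff by (intro bex_cong refl) (rule eq_commute)
  then show ?thesis by (simp add: set_eq_subset image_subset_iff image_iff)
qed

text \<open>Variable \<open>j * b + u\<close> stands for the image of the vertex \<open>u\<close> of
  \<open>F\<close> in copy number \<open>j\<close>. All quantifiers range over finite index sets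
  given by \<open>F\<close> and \<open>m\<close>, so they become finite conjunctions and
  disjunctions.\<close>

lemma qf_definable_distinct_copies:
  fixes F :: "nat set set"
  assumes fin: "finite F" and two: "\<forall>e\<in>F. card e = 2" and b: "\<Union>F \<subseteq> {..<b}" and pos: "0 < m * b"
  shows "qf_definable (m * b) (\<lambda>G v.
    (\<forall>j<m. inj_on (\<lambda>u. v (j * b + u)) (\<Union>F) \<and> (`) (\<lambda>u. v (j * b + u)) ` F \<subseteq> edges G) \<and>
    (\<forall>i<m. \<forall>j<m. i \<noteq> j \<longrightarrow> (`) (\<lambda>u. v (i * b + u)) ` F \<noteq> (`) (\<lambda>u. v (j * b + u)) ` F))"
    (is "qf_definable _ ?P")
proof -
  have fe: "finite e" if "e \<in> F" for e using two that by (metis card.infinite zero_neq_numeral)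
  have m0: "0 < m" and b0: "0 < b" using pos by auto
  have lt: "u < b" if "u \<in> e" "e \<in> F" for u e using b that by auto
  have idx: "j * b + u < m * b" if "j < m" "u < b" for j u
  proof -
    have "j * b + u < Suc j * b" using that by auto
    also have "\<dots> \<le> m * b" using that by (intro mult_le_mono1) auto
    finally show ?thesis .
  qed
  have edge: "f ` e \<in> edges G \<longleftrightarrow> (\<forall>x\<in>e. \<forall>y\<in>e - {x}. adjacent G (f x) (f y))"
    if e: "e \<in> F" for f e and G :: "'a graph"
  proof -
    obtain x y where xy: "e = {x, y}" "x \<noteq> y" using two e by (auto simp: card_2_iff)
    have "{x, y} - {x} = {y}" "{x, y} - {y} = {x}" using xy(2) by auto
    then show ?thesis unfolding xy(1) adjacent_def by (simp add: insert_commute[of "f x"])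
  qed
  \<comment> \<open>Inequalities between indices are not formulas about \<open>G\<close>. They move
    into the ranges \<open>{..<m} - {i}\<close> and \<open>e - {x}\<close>, and only atoms about
    \<open>v\<close> and adjacency remain.\<close>
  have eq: "?P = (\<lambda>G v.
    (\<forall>j\<in>{..<m}. (\<forall>d\<in>F. \<forall>x\<in>d. \<forall>e\<in>F. \<forall>y\<in>e - {x}. \<not> v (j * b + x) = v (j * b + y)) \<and>
       (\<forall>e\<in>F. \<forall>x\<in>e. \<forall>y\<in>e - {x}. adjacent G (v (j * b + x)) (v (j * b + y)))) \<and>
    (\<forall>i\<in>{..<m}. \<forall>j\<in>{..<m} - {i}. \<not>
       ((\<forall>d\<in>F. \<exists>e\<in>F. (\<forall>x\<in>d. \<exists>y\<in>e. v (i * b + x) = v (j * b + y)) \<and> (\<forall>y\<in>e. \<exists>x\<in>d. v (i * b + x) = v (j * b + y))) \<and>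
        (\<forall>e\<in>F. \<exists>d\<in>F. (\<forall>x\<in>d. \<exists>y\<in>e. v (i * b + x) = v (j * b + y)) \<and> (\<forall>y\<in>e. \<exists>x\<in>d. v (i * b + x) = v (j * b + y))))))"
  proof (intro ext)
    fix G :: "'a graph" and v :: "nat \<Rightarrow> 'a"
    have 1: "inj_on (\<lambda>u. v (j * b + u)) (\<Union>F) \<longleftrightarrow>
      (\<forall>d\<in>F. \<forall>x\<in>d. \<forall>e\<in>F. \<forall>y\<in>e - {x}. \<not> v (j * b + x) = v (j * b + y))" for j
      unfolding inj_on_def by blast
    have 2: "(`) (\<lambda>u. v (j * b + u)) ` F \<subseteq> edges G \<longleftrightarrow>
      (\<forall>e\<in>F. \<forall>x\<in>e. \<forall>y\<in>e - {x}. adjacent G (v (j * b + x)) (v (j * b + y)))" for j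
      unfolding image_subset_iff by (rule ball_cong[OF refl edge])
    have 3: "(\<forall>j\<in>{..<m}. i \<noteq> j \<longrightarrow> Q j) \<longleftrightarrow> (\<forall>j\<in>{..<m} - {i}. Q j)" for Q i by auto
    have 4: "(\<forall>j<m. Q j) \<longleftrightarrow> (\<forall>j\<in>{..<m}. Q j)" for Q by auto
    show "?P G v = ((\<forall>j\<in>{..<m}. (\<forall>d\<in>F. \<forall>x\<in>d. \<forall>e\<in>F. \<forall>y\<in>e - {x}. \<not> v (j * b + x) = v (j * b + y)) \<and>
       (\<forall>e\<in>F. \<forall>x\<in>e. \<forall>y\<in>e - {x}. adjacent G (v (j * b + x)) (v (j * b + y)))) \<and>
    (\<forall>i\<in>{..<m}. \<forall>j\<in>{..<m} - {i}. \<not>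
       ((\<forall>d\<in>F. \<exists>e\<in>F. (\<forall>x\<in>d. \<exists>y\<in>e. v (i * b + x) = v (j * b + y)) \<and> (\<forall>y\<in>e. \<exists>x\<in>d. v (i * b + x) = v (j * b + y))) \<and>
        (\<forall>e\<in>F. \<exists>d\<in>F. (\<forall>x\<in>d. \<exists>y\<in>e. v (i * b + x) = v (j * b + y)) \<and> (\<forall>y\<in>e. \<exists>x\<in>d. v (i * b + x) = v (j * b + y))))))"
      unfolding 1 2 4 3 image_eq_image_iff ..
  qed
  show ?thesis unfolding eq
    by (intro qf_definable_conj qf_definable_not qf_definable_ball qf_definable_bex
        qf_definable_eq qf_definable_adjacent)
      (auto simp: fin fe m0 b0 intro!: idx intro: lt)
qed

text \<open>One block of \<open>m * b\<close> existential quantifiers names the vertices of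
  \<open>m\<close> pairwise distinct copies, with \<open>b\<close> variables reserved for
  each.\<close>

lemma count_copies_definable:
  fixes F :: "nat set set"
  assumes fin: "finite F" and ne: "F \<noteq> {}" and two: "\<forall>e\<in>F. card e = 2"
    and b: "\<Union>F \<subseteq> {..<b}" and m: "0 < m"
  obtains \<phi> where "sentence \<phi>" "quantifier_depth \<phi> = m * b"
    "\<And>G :: 'a graph. finite (verts G) \<Longrightarrow> models G \<phi> \<longleftrightarrow> m \<le> count_copies F G"
proof -
  have "\<Union>F \<noteq> {}" using ne two by fastforce
  then obtain u0 where u0: "u0 \<in> \<Union>F" by auto
  then have bpos: "0 < b" using b by auto
  define P where "P = (\<lambda>(G :: 'a graph) v.
    (\<forall>j<m. inj_on (\<lambda>u. v (j * b + u)) (\<Union>F) \<and> (`) (\<lambda>u. v (j * b + u)) ` F \<subseteq> edges G) \<and>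
    (\<forall>i<m. \<forall>j<m. i \<noteq> j \<longrightarrow> (`) (\<lambda>u. v (i * b + u)) ` F \<noteq> (`) (\<lambda>u. v (j * b + u)) ` F))"
  have "qf_definable (m * b) P"
    unfolding P_def using qf_definable_distinct_copies[OF fin two b] m bpos by simp
  then obtain \<psi> where \<psi>: "quantifier_depth \<psi> = 0" "free_vars \<psi> \<subseteq> {..<m * b}"
    "\<And>G v. sat G v \<psi> \<longleftrightarrow> P G v"
    unfolding qf_definable_def by blast
  have idx: "j * b + u < m * b" if "j < m" "u < b" for j u
  proof -
    have "j * b + u < Suc j * b" using that by auto
    also have "\<dots> \<le> m * b" using that by (intro mult_le_mono1) auto
    finally show ?thesis .
  qed
  have "models G (exists_upto (m * b) \<psi>) \<longleftrightarrow> m \<le> count_copies F G"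
    if finG: "finite (verts G)" for G :: "'a graph"
  proof -
    define X where "X = {S \<in> copies F (verts G). S \<subseteq> edges G}"
    have finX: "finite X" unfolding X_def by (rule finite_subset[OF _ finite_copies[OF finG]]) auto
    have "m \<le> card X" if "sat G v (exists_upto (m * b) \<psi>)" for v
    proof -
      from that obtain w where w: "\<forall>i<m * b. w i \<in> verts G" "P G w"
        unfolding sat_exists_upto \<psi>(3) by blast
      define h where "h j = (`) (\<lambda>u. w (j * b + u)) ` F" for j
      have "inj_on h {..<m}" using w(2) by (auto simp: P_def h_def inj_on_def)
      moreover have "h ` {..<m} \<subseteq> X"
      proof (clarify)
        fix j assume j: "j < m"
        have "w (j * b + u) \<in> verts G" if "u \<in> \<Union>F" for u
          using w(1) idx[OF j, of u] b that by blast
        then have "(\<lambda>u. w (j * b + u)) ` \<Union>F \<subseteq> verts G" by blast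
        moreover have "inj_on (\<lambda>u. w (j * b + u)) (\<Union>F)" "h j \<subseteq> edges G"
          using w(2) j unfolding P_def h_def by blast+
        ultimately show "h j \<in> X" unfolding X_def copies_def h_def by blast
      qed
      ultimately show ?thesis using card_inj_on_le[OF _ _ finX, of h "{..<m}"] by simp
    qed
    moreover have "sat G v (exists_upto (m * b) \<psi>)" if "m \<le> card X" for v
    proof -
      from that obtain Y where Y: "Y \<subseteq> X" "card Y = m" by (meson obtain_subset_with_card_n)
      obtain h where h: "bij_betw h {..<m} Y"
        using Y finX by (metis card_lessThan finite_lessThan finite_same_card_bij finite_subset)
      have hX: "h j \<in> X" if "j < m" for j using h Y that by (auto simp: bij_betw_def)
      have "\<forall>j\<in>{..<m}. \<exists>\<tau>. inj_on \<tau> (\<Union>F) \<and> \<tau> ` \<Union>F \<subseteq> verts G \<and> h j = (`) \<tau> ` F"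
      proof
        fix j assume "j \<in> {..<m}"
        then have "h j \<in> copies F (verts G)" using hX by (simp add: X_def)
        then show "\<exists>\<tau>. inj_on \<tau> (\<Union>F) \<and> \<tau> ` \<Union>F \<subseteq> verts G \<and> h j = (`) \<tau> ` F"
          unfolding copies_def mem_Collect_eq by (elim exE conjE) (intro exI conjI)
      qed
      then obtain \<sigma> where "\<forall>j\<in>{..<m}. inj_on (\<sigma> j) (\<Union>F) \<and> \<sigma> j ` \<Union>F \<subseteq> verts G \<and> h j = (`) (\<sigma> j) ` F"
        by (rule bchoice[THEN exE])
      then have \<sigma>: "\<And>j. j < m \<Longrightarrow> inj_on (\<sigma> j) (\<Union>F)"
        "\<And>j. j < m \<Longrightarrow> \<sigma> j ` \<Union>F \<subseteq> verts G" "\<And>j. j < m \<Longrightarrow> h j = (`) (\<sigma> j) ` F"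
        unfolding lessThan_iff Ball_def by blast+
      \<comment> \<open>Every one of the \<open>m * b\<close> variables is quantified over
        \<open>verts G\<close>, including those in a block that belong to no vertex of
        \<open>F\<close>. These receive the image of the dummy vertex \<open>u0\<close>.\<close>
      define w where "w i = (if i < m * b then \<sigma> (i div b) (if i mod b \<in> \<Union>F then i mod b else u0) else v i)" for i
      have wj: "w (j * b + u) = \<sigma> j u" if "j < m" "u \<in> \<Union>F" for j u
      proof -
        have "u < b" using that b by auto
        then have "j * b + u < m * b" "(j * b + u) div b = j" "(j * b + u) mod b = u"
          using idx[OF that(1)] bpos by auto
        then show ?thesis using that by (simp add: w_def)
      qed
      have hw: "(`) (\<lambda>u. w (j * b + u)) ` F = h j" if "j < m" for j
        unfolding \<sigma>(3)[OF that] using wj[OF that] by (intro image_cong refl) blast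
      have "w i \<in> verts G" if "i < m * b" for i
      proof -
        have "i div b < m" using that by (simp add: less_mult_imp_div_less)
        then show ?thesis using \<sigma>(2)[of "i div b"] that u0 by (auto simp: w_def)
      qed
      moreover have "P G w"
        unfolding P_def
      proof (intro conjI allI impI)
        fix j assume j: "j < m"
        show "inj_on (\<lambda>u. w (j * b + u)) (\<Union>F)"
          using \<sigma>(1)[OF j] wj[OF j] by (subst inj_on_cong[of _ _ "\<sigma> j"]) auto
        show "(`) (\<lambda>u. w (j * b + u)) ` F \<subseteq> edges G"
          using hX[OF j] by (simp add: hw[OF j] X_def)
      next
        fix i j assume ij: "i < m" "j < m" "i \<noteq> j"
        then have "h i \<noteq> h j" using h by (auto simp: bij_betw_def inj_on_def)
        then show "(`) (\<lambda>u. w (i * b + u)) ` F \<noteq> (`) (\<lambda>u. w (j * b + u)) ` F"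
          using ij by (simp add: hw)
      qed
      ultimately show ?thesis
        unfolding sat_exists_upto \<psi>(3) by (intro exI[of _ w]) (auto simp: w_def)
    qed
    ultimately show ?thesis unfolding models_def count_copies_def X_def by blast
  qed
  moreover have "sentence (exists_upto (m * b) \<psi>)"
    using \<psi>(2) by (auto simp: sentence_def free_vars_exists_upto)
  moreover have "quantifier_depth (exists_upto (m * b) \<psi>) = m * b"
    using \<psi>(1) by (simp add: quantifier_depth_exists_upto)
  ultimately show thesis using that by blast
qed

text \<open>With \<open>m\<close> one above the smaller count, containing \<open>m\<close> copies is
  true only in the graph with the larger count. Since the minimum is at most the first count, a
  bound on that count alone gives \<open>m \<le> M\<close>.\<close>

lemma fo_distinguishability_le:
  fixes F :: "nat set set" and G\<^sub>1 G\<^sub>2 :: "'a graph"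
  assumes "finite F" "F \<noteq> {}" "\<forall>e\<in>F. card e = 2" "\<Union>F \<subseteq> {..<b}"
    and "finite (verts G\<^sub>1)" "finite (verts G\<^sub>2)"
    and "count_copies F G\<^sub>1 \<noteq> count_copies F G\<^sub>2" "count_copies F G\<^sub>1 < M"
  shows "fo_distinguishability G\<^sub>1 G\<^sub>2 \<le> enat (M * b)"
proof -
  define m where "m = Suc (min (count_copies F G\<^sub>1) (count_copies F G\<^sub>2))"
  obtain \<phi> where \<phi>: "sentence \<phi>" "quantifier_depth \<phi> = m * b"
    "\<And>G :: 'a graph. finite (verts G) \<Longrightarrow> models G \<phi> \<longleftrightarrow> m \<le> count_copies F G"
    using count_copies_definable[OF assms(1-4), of m] by (auto simp: m_def)
  have "distinguishes \<phi> G\<^sub>1 G\<^sub>2"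
    using \<phi>(3) assms(5-7) by (auto simp: distinguishes_def m_def min_def)
  then have "fo_distinguishability G\<^sub>1 G\<^sub>2 \<le> enat (quantifier_depth \<phi>)"
    unfolding fo_distinguishability_def using \<phi>(1) by (intro Inf_lower) auto
  also have "\<dots> \<le> enat (M * b)"
    using assms(8) by (auto simp: \<phi>(2) m_def simp del: mult_Suc intro!: mult_le_mono1)
  finally show ?thesis .
qed

section \<open>Anti-concentration of counts in random sets\<close>

text \<open>The sequence starts above \<open>\<epsilon>\<close> and decays too slowly to fall below
  half of it within \<open>W\<close> steps: by Bernoulli's inequality the factors multiply to at
  least 3/4, and the additive losses total at most \<open>\<epsilon> / 4\<close>. Then
  \<open>W\<close> terms of size \<open>\<epsilon> / 2\<close> already sum to 2.\<close>

lemma sum_window_gt_one: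
  fixes b :: "nat \<Rightarrow> real"
  assumes \<epsilon>: "0 < \<epsilon>" and W: "4 / \<epsilon> \<le> real W" "0 < W"
    and b0: "\<epsilon> < b 0"
    and step: "\<And>i. i < W \<Longrightarrow> (1 - 1 / (4 * real W)) * b i - \<epsilon> / (4 * real W) \<le> b (Suc i)"
  shows "1 < (\<Sum>i<W. b i)"
proof -
  define r where "r = 1 - 1 / (4 * real W)"
  define \<eta> where "\<eta> = \<epsilon> / (4 * real W)"
  have r: "0 \<le> r" "r \<le> 1" using W by (auto simp: r_def field_simps)
  have \<eta>: "0 \<le> \<eta>" using \<epsilon> by (simp add: \<eta>_def)
  have low: "r ^ i * b 0 - i * \<eta> \<le> b i" if "i \<le> W" for i
    using that
  proof (induction i)
    case (Suc i)
    have "r * (i * \<eta>) \<le> 1 * (i * \<eta>)" using r \<eta> by (intro mult_right_mono) auto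
    moreover have "r * (r ^ i * b 0 - i * \<eta>) \<le> r * b i"
      using Suc r by (intro mult_left_mono) auto
    moreover have "r * b i - \<eta> \<le> b (Suc i)"
      using step[of i] Suc.prems by (simp add: r_def \<eta>_def)
    ultimately show ?case by (simp add: algebra_simps)
  qed simp
  have half: "\<epsilon> / 2 \<le> b i" if "i < W" for i
  proof -
    have iW: "i / (4 * real W) \<le> 1 / 4" using that W by (simp add: field_simps)
    have "1 + real i * (- (1 / (4 * real W))) \<le> (1 + - (1 / (4 * real W))) ^ i"
      by (rule Bernoulli_inequality) (use W in \<open>simp add: field_simps\<close>)
    then have "3 / 4 \<le> r ^ i" using iW by (simp add: r_def)
    then have "3 / 4 * \<epsilon> \<le> r ^ i * b 0" using b0 \<epsilon> r by (intro mult_mono) auto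
    moreover have "i * \<eta> \<le> \<epsilon> / 4"
      using mult_left_mono[OF iW, of \<epsilon>] \<epsilon> by (simp add: \<eta>_def field_simps)
    ultimately show ?thesis using low[of i] that by simp
  qed
  have "2 \<le> W * (\<epsilon> / 2)" using W \<epsilon> by (simp add: field_simps)
  also have "\<dots> = (\<Sum>i<W. \<epsilon> / 2)" by simp
  also have "\<dots> \<le> (\<Sum>i<W. b i)" using half by (intro sum_mono) auto
  finally show ?thesis by simp
qed

text \<open>Exact recursion with \<open>\<eta> = 0\<close> characterises the Poisson weights of mean \<open>\<mu>\<close>. Within distance \<open>\<surd>\<mu>\<close>
  of the mode consecutive weights have ratio close to \<open>1\<close>, so a large weight would be repeated too often.\<close>

lemma approx_poisson_anticoncentration:
  fixes \<epsilon> :: real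
  assumes "0 < \<epsilon>"
  obtains \<mu> \<eta> :: real where "1 \<le> \<mu>" "0 < \<eta>"
    "\<And>(a :: nat \<Rightarrow> real) m. (\<And>I. finite I \<Longrightarrow> sum a I \<le> 1) \<Longrightarrow> (\<And>j. 0 \<le> a j) \<Longrightarrow>
      (\<And>j. \<bar>real (Suc j) * a (Suc j) - \<mu> * a j\<bar> \<le> \<eta>) \<Longrightarrow> a m \<le> \<epsilon>"
proof -
  define W where "W = Suc (nat \<lceil>4 / \<epsilon>\<rceil>)"
  define r where "r = 1 - 1 / (4 * real W)"
  define \<eta> where "\<eta> = \<epsilon> / (4 * real W)"
  \<comment> \<open>This choice gives \<open>1 / (4 * W) = W / \<mu>\<close>, so the one factor
    \<open>r\<close> absorbs a deviation of the index from \<open>\<mu>\<close> by up to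
    \<open>W\<close> on either side; see \<open>r1\<close> and \<open>r2\<close>.\<close>
  define \<mu> where "\<mu> = 4 * real W ^ 2"
  have W: "4 / \<epsilon> \<le> real W" "0 < W" "1 \<le> real W" unfolding W_def by linarith+
  have r: "0 \<le> r" "r \<le> 1" using W by (auto simp: r_def field_simps)
  have \<eta>: "0 < \<eta>" using assms W by (simp add: \<eta>_def)
  have "real W * 1 \<le> real W * real W" using W by (intro mult_left_mono) auto
  then have "W \<le> \<mu>" unfolding \<mu>_def power2_eq_square using W by linarith
  then have WL: "W \<le> \<mu>" "1 \<le> \<mu>" using W by linarith+
  have r1: "r * (\<mu> + W) \<le> \<mu>" using W by (simp add: r_def \<mu>_def power2_eq_square field_simps)
  have r2: "r * \<mu> = \<mu> - W" using W by (simp add: r_def \<mu>_def power2_eq_square field_simps)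
  have "a m \<le> \<epsilon>"
    if sum1: "\<And>I. finite I \<Longrightarrow> sum a I \<le> 1" and nn: "\<And>j. 0 \<le> a j"
      and rec: "\<And>j. \<bar>real (Suc j) * a (Suc j) - \<mu> * a j\<bar> \<le> \<eta>" for a :: "nat \<Rightarrow> real" and m
  proof (rule ccontr)
    assume big: "\<not> a m \<le> \<epsilon>"
    \<comment> \<open>The window runs from \<open>m\<close> towards the mode and at most
      \<open>W\<close> beyond it: upwards for \<open>m \<le> \<mu>\<close>, downwards otherwise.
      Before the mode the weights essentially increase, so a distant \<open>m\<close> does no
      harm.\<close>
    show False
    proof (cases "m \<le> \<mu>")
      case True
      have "1 < (\<Sum>i<W. a (m + i))"
      proof (rule sum_window_gt_one[OF assms W(1,2)])
        fix i assume i: "i < W"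
        define s where "s = real (Suc (m + i))"
        have s: "1 \<le> s" "s \<le> \<mu> + W" using i True by (auto simp: s_def)
        have "r * s \<le> \<mu>" using mult_left_mono[OF s(2) r(1)] r1 by linarith
        then have "r * s * a (m + i) \<le> \<mu> * a (m + i)" using nn by (intro mult_right_mono) auto
        moreover have "\<eta> \<le> s * \<eta>" using s \<eta> by simp
        moreover have "\<mu> * a (m + i) - \<eta> \<le> s * a (Suc (m + i))"
          using rec[of "m + i"] unfolding s_def by linarith
        ultimately have "s * (r * a (m + i) - \<eta>) \<le> s * a (Suc (m + i))" by (simp add: algebra_simps)
        then show "(1 - 1 / (4 * real W)) * a (m + i) - \<epsilon> / (4 * real W) \<le> a (m + Suc i)"
          using s by (simp add: r_def \<eta>_def)
      qed (use big in auto)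
      also have "(\<Sum>i<W. a (m + i)) = sum a ((+) m ` {..<W})"
        by (subst sum.reindex) auto
      finally show False using sum1[of "(+) m ` {..<W}"] by simp
    next
      case False
      then have mW: "W < m" using WL by linarith
      have "1 < (\<Sum>i<W. a (m - i))"
      proof (rule sum_window_gt_one[OF assms W(1,2)])
        fix i assume i: "i < W"
        define k where "k = m - Suc i"
        have k: "Suc k = m - i" using i mW by (simp add: k_def)
        have "\<mu> - W \<le> real (Suc k)" using False i mW unfolding k by simp
        then have "r * \<mu> * a (Suc k) \<le> real (Suc k) * a (Suc k)"
          using nn by (intro mult_right_mono) (auto simp: r2)
        moreover have "\<eta> \<le> \<mu> * \<eta>" using WL \<eta> by simp
        moreover have "real (Suc k) * a (Suc k) - \<eta> \<le> \<mu> * a k"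
          using rec[of k] by linarith
        ultimately have "\<mu> * (r * a (Suc k) - \<eta>) \<le> \<mu> * a k" by (simp add: algebra_simps)
        then show "(1 - 1 / (4 * real W)) * a (m - i) - \<epsilon> / (4 * real W) \<le> a (m - Suc i)"
          using WL by (simp add: r_def \<eta>_def k[symmetric] k_def[symmetric])
      qed (use big in auto)
      also have "(\<Sum>i<W. a (m - i)) = sum a ((-) m ` {..<W})"
        using mW by (subst sum.reindex) (auto simp: inj_on_def)
      finally show False using sum1[of "(-) m ` {..<W}"] by simp
    qed
  qed
  then show thesis using that \<eta> WL by blast
qed

section \<open>Random subsets with independent elements\<close>

definition random_subset :: "'a set \<Rightarrow> real \<Rightarrow> 'a set pmf" where
  "random_subset A p = map_pmf (\<lambda>\<omega>. {x \<in> A. \<omega> x}) (Pi_pmf A False (\<lambda>_. bernoulli_pmf p))"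

lemma set_random_subset: "set_pmf (random_subset A p) \<subseteq> Pow A"
  by (auto simp: random_subset_def)

lemma pmf_random_subset:
  assumes "finite A" "E \<subseteq> A" "0 \<le> p" "p \<le> 1"
  shows "pmf (random_subset A p) E = (\<Prod>x\<in>A. if x \<in> E then p else 1 - p)"
proof -
  have "(\<lambda>\<omega>. {x \<in> A. \<omega> x}) -` {E} = Pi A (\<lambda>x. {x \<in> E})" using assms(2) by auto
  then have "pmf (random_subset A p) E =
      measure_pmf.prob (Pi_pmf A False (\<lambda>_. bernoulli_pmf p)) (Pi A (\<lambda>x. {x \<in> E}))"
    unfolding random_subset_def pmf_map by simp
  also have "\<dots> = (\<Prod>x\<in>A. measure_pmf.prob (bernoulli_pmf p) {x \<in> E})"
    by (rule measure_Pi_pmf_Pi[OF assms(1)])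
  also have "\<dots> = (\<Prod>x\<in>A. if x \<in> E then p else 1 - p)"
    using assms by (intro prod.cong refl) (auto simp: measure_pmf_single)
  finally show ?thesis .
qed

lemma prob_random_subset_all:
  assumes "finite S" "0 \<le> p" "p \<le> 1"
  shows "measure_pmf.prob (random_subset S p) {S} = p ^ card S"
  using assms by (simp add: measure_pmf_single pmf_random_subset)

lemma random_subset_split:
  assumes "finite A" "S \<subseteq> A"
  shows "random_subset A p = map_pmf (\<lambda>(U, V). U \<union> V) (pair_pmf (random_subset S p) (random_subset (A - S) p))"
proof -
  have A: "A = S \<union> (A - S)" using assms by auto
  have fin: "finite S" "finite (A - S)" using assms finite_subset by auto
  have "Pi_pmf A False (\<lambda>_. bernoulli_pmf p) = map_pmf (\<lambda>(f, g) x. if x \<in> S then f x else g x)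
      (pair_pmf (Pi_pmf S False (\<lambda>_. bernoulli_pmf p)) (Pi_pmf (A - S) False (\<lambda>_. bernoulli_pmf p)))"
    by (subst A) (rule Pi_pmf_union[OF fin], auto)
  then show ?thesis
    unfolding random_subset_def pair_map_pmf1 pair_map_pmf2
    using assms(2) by (auto simp: pmf.map_comp o_def case_prod_unfold intro!: map_pmf_cong)
qed

text \<open>The hypothesis says that \<open>Q\<close> ignores the elements of \<open>S\<close>, so
  it is independent of \<open>S \<subseteq> E\<close>. Splitting the ground set into
  \<open>S\<close> and its complement turns both events into rectangles of a product
  measure.\<close>

lemma prob_random_subset_superset_and:
  assumes "finite A" "S \<subseteq> A" "0 \<le> p" "p \<le> 1" and Q: "\<And>E. Q E \<longleftrightarrow> Q (E - S)"
  shows "measure_pmf.prob (random_subset A p) {E. S \<subseteq> E \<and> Q E} =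
    p ^ card S * measure_pmf.prob (random_subset A p) {E. Q E}"
proof -
  define M where "M = pair_pmf (random_subset S p) (random_subset (A - S) p)"
  have fin: "finite S" "finite (A - S)" using assms finite_subset by auto
  have supp: "U \<subseteq> S" "V \<subseteq> A - S" if "(U, V) \<in> set_pmf M" for U V
    using that set_random_subset[of S p] set_random_subset[of "A - S" p] by (auto simp: M_def)
  have Q': "Q (U \<union> V) \<longleftrightarrow> Q V" if "(U, V) \<in> set_pmf M" for U V
  proof -
    have "(U \<union> V) - S = V - S" using supp[OF that] by auto
    then show ?thesis using Q[of "U \<union> V"] Q[of V] by simp
  qed
  define B where "B = {V \<in> Pow (A - S). Q V}"
  have iff1: "S \<subseteq> U \<union> V \<and> Q (U \<union> V) \<longleftrightarrow> U = S \<and> V \<in> B"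
    and iff2: "Q (U \<union> V) \<longleftrightarrow> U \<subseteq> S \<and> V \<in> B" if "(U, V) \<in> set_pmf M" for U V
    using supp[OF that] Q'[OF that] unfolding B_def by blast+
  have fB: "countable B" using fin by (simp add: B_def countable_finite)
  have "measure_pmf.prob M ((\<lambda>(U, V). U \<union> V) -` {E. S \<subseteq> E \<and> Q E}) = measure_pmf.prob M ({S} \<times> B)"
    by (subst (1 2) measure_Int_set_pmf[symmetric], rule arg_cong[where f = "measure_pmf.prob M"])
      (use iff1 in auto)
  also have "\<dots> = p ^ card S * measure_pmf.prob (random_subset (A - S) p) B"
    unfolding M_def using fB fin assms by (subst measure_pmf_prob_product) (auto simp: prob_random_subset_all)
  finally have 1: "measure_pmf.prob (random_subset A p) {E. S \<subseteq> E \<and> Q E} =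
      p ^ card S * measure_pmf.prob (random_subset (A - S) p) B"
    unfolding random_subset_split[OF assms(1,2)] M_def by simp
  have "measure_pmf.prob M ((\<lambda>(U, V). U \<union> V) -` {E. Q E}) = measure_pmf.prob M (Pow S \<times> B)"
    by (subst (1 2) measure_Int_set_pmf[symmetric], rule arg_cong[where f = "measure_pmf.prob M"])
      (use iff2 in auto)
  also have "\<dots> = measure_pmf.prob (random_subset S p) (Pow S) * measure_pmf.prob (random_subset (A - S) p) B"
    unfolding M_def using fB fin by (subst measure_pmf_prob_product) (auto simp: countable_finite)
  also have "measure_pmf.prob (random_subset S p) (Pow S) = 1"
    using set_random_subset[of S p] by (simp add: measure_pmf.prob_eq_1 AE_measure_pmf_iff subset_iff)
  finally have 2: "measure_pmf.prob (random_subset A p) {E. Q E} = measure_pmf.prob (random_subset (A - S) p) B"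
    unfolding random_subset_split[OF assms(1,2)] M_def by simp
  show ?thesis unfolding 1 2 ..
qed

lemma prob_random_subset_superset:
  assumes "finite A" "S \<subseteq> A" "0 \<le> p" "p \<le> 1"
  shows "measure_pmf.prob (random_subset A p) {E. S \<subseteq> E} = p ^ card S"
  using prob_random_subset_superset_and[OF assms, of "\<lambda>_. True"] by simp

text \<open>Finite sums over \<open>Pow A\<close> allow means of counts to be double counted by
  \<open>sum.swap\<close>.\<close>

lemma prob_random_subset_eq_sum:
  assumes "finite A"
  shows "measure_pmf.prob (random_subset A p) X =
    (\<Sum>E\<in>Pow A. pmf (random_subset A p) E * of_bool (E \<in> X))"
proof -
  have "measure_pmf.prob (random_subset A p) X = measure_pmf.prob (random_subset A p) (X \<inter> Pow A)"
    by (subst (1 2) measure_Int_set_pmf[symmetric], rule arg_cong[where f = "measure_pmf.prob _"])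
      (use set_random_subset[of A p] in auto)
  also have "\<dots> = (\<Sum>E\<in>X \<inter> Pow A. pmf (random_subset A p) E)"
    using assms by (intro measure_measure_pmf_finite) auto
  also have "\<dots> = (\<Sum>E\<in>Pow A. pmf (random_subset A p) E * of_bool (E \<in> X))"
    using assms by (intro sum.mono_neutral_cong_left) auto
  finally show ?thesis .
qed

lemma abs_prob_diff_le:
  assumes "X - Z \<subseteq> Y" "Y - Z \<subseteq> X"
  shows "\<bar>measure_pmf.prob M X - measure_pmf.prob M Y\<bar> \<le> measure_pmf.prob M Z"
proof -
  have "measure_pmf.prob M X \<le> measure_pmf.prob M (Y \<union> Z)"
    using assms by (intro measure_pmf.finite_measure_mono) auto
  also have "\<dots> \<le> measure_pmf.prob M Y + measure_pmf.prob M Z" by (intro measure_Un_le) auto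
  finally have 1: "measure_pmf.prob M X \<le> measure_pmf.prob M Y + measure_pmf.prob M Z" .
  have "measure_pmf.prob M Y \<le> measure_pmf.prob M (X \<union> Z)"
    using assms by (intro measure_pmf.finite_measure_mono) auto
  also have "\<dots> \<le> measure_pmf.prob M X + measure_pmf.prob M Z" by (intro measure_Un_le) auto
  finally show ?thesis using 1 by linarith
qed

lemma prob_exists_superset_le:
  assumes "finite A" "finite \<T>" "\<And>T. T \<in> \<T> \<Longrightarrow> T \<subseteq> A" "0 \<le> p" "p \<le> 1"
  shows "measure_pmf.prob (random_subset A p) {E. \<exists>T\<in>\<T>. T \<subseteq> E} \<le> (\<Sum>T\<in>\<T>. p ^ card T)"
proof -
  have eq: "{E. \<exists>T\<in>\<T>. T \<subseteq> E} = (\<Union>T\<in>\<T>. {E. T \<subseteq> E})" by auto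
  have "measure_pmf.prob (random_subset A p) (\<Union>T\<in>\<T>. {E. T \<subseteq> E}) \<le>
      (\<Sum>T\<in>\<T>. measure_pmf.prob (random_subset A p) {E. T \<subseteq> E})"
    using assms by (intro measure_UNION_le) auto
  also have "\<dots> = (\<Sum>T\<in>\<T>. p ^ card T)"
    using assms by (intro sum.cong refl prob_random_subset_superset) auto
  finally show ?thesis unfolding eq .
qed

text \<open>On \<open>N = Suc m\<close> exactly \<open>Suc m\<close> members lie in
  \<open>E\<close>, so the first product is the sum over \<open>S\<close> of the probability of
  \<open>S \<subseteq> E\<close> and \<open>N = Suc m\<close>. For fixed \<open>S\<close> let
  \<open>N'\<close> count only the members disjoint from \<open>S\<close>; it is independent of
  \<open>S \<subseteq> E\<close>. Given \<open>S \<subseteq> E\<close>, replacing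
  \<open>N = Suc m\<close> by \<open>N' = m\<close> fails only if another member meeting
  \<open>S\<close> appears, which is the first error sum. Going back from \<open>N' = m\<close> to
  \<open>N = m\<close>, under the factor \<open>p ^ e\<close>, fails only if some member meeting
  \<open>S\<close> appears, which is the second.\<close>

lemma count_recursion:
  fixes A :: "'a set" and p :: real
  assumes A: "finite A" and fin: "finite \<F>" and sub: "\<And>S. S \<in> \<F> \<Longrightarrow> S \<subseteq> A"
    and card: "\<And>S. S \<in> \<F> \<Longrightarrow> card S = e" and e: "0 < e" and p: "0 \<le> p" "p \<le> 1"
  defines "a \<equiv> \<lambda>m. measure_pmf.prob (random_subset A p) {E. card {S \<in> \<F>. S \<subseteq> E} = m}"
  shows "\<bar>real (Suc m) * a (Suc m) - card \<F> * p ^ e * a m\<bar> \<le>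
    (\<Sum>S\<in>\<F>. \<Sum>T\<in>{T \<in> \<F>. T \<noteq> S \<and> T \<inter> S \<noteq> {}}. p ^ card (S \<union> T)) +
    (\<Sum>S\<in>\<F>. \<Sum>T\<in>{T \<in> \<F>. T \<inter> S \<noteq> {}}. p ^ (2 * e))"
proof -
  let ?P = "measure_pmf.prob (random_subset A p)"
  define N where "N E = card {S \<in> \<F>. S \<subseteq> E}" for E
  define near where "near S = {T \<in> \<F>. T \<inter> S \<noteq> {}}" for S
  define N' where "N' S E = card {T \<in> \<F> - near S. T \<subseteq> E}" for S E
  have finn: "finite (near S)" for S using fin by (simp add: near_def)
  have split: "N E = N' S E + card {T \<in> near S. T \<subseteq> E}" for S E
  proof -
    have "{T \<in> \<F>. T \<subseteq> E} = {T \<in> \<F> - near S. T \<subseteq> E} \<union> {T \<in> near S. T \<subseteq> E}" by (auto simp: near_def)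
    then show ?thesis unfolding N_def N'_def using fin finn by (simp, subst card_Un_disjoint) auto
  qed
  have "real (Suc m) * ?P {E. N E = Suc m} = (\<Sum>S\<in>\<F>. ?P {E. S \<subseteq> E \<and> N E = Suc m})"
  proof -
    have count: "real (Suc m) * of_bool (N E = Suc m) = (\<Sum>S\<in>\<F>. of_bool (S \<subseteq> E \<and> N E = Suc m))" for E
    proof (cases "N E = Suc m")
      case True
      have "(\<Sum>S\<in>\<F>. of_bool (S \<subseteq> E)) = real (N E)"
        unfolding N_def using fin by (simp add: of_bool_def sum.If_cases Int_def)
      then show ?thesis using True by simp
    qed simp
    have "real (Suc m) * ?P {E. N E = Suc m} =
        (\<Sum>E\<in>Pow A. pmf (random_subset A p) E * (real (Suc m) * of_bool (N E = Suc m)))"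
      by (simp add: prob_random_subset_eq_sum[OF A] sum_distrib_left mult_ac del: of_nat_Suc)
    also have "\<dots> = (\<Sum>S\<in>\<F>. \<Sum>E\<in>Pow A. pmf (random_subset A p) E * of_bool (S \<subseteq> E \<and> N E = Suc m))"
      unfolding count sum_distrib_left by (rule sum.swap)
    also have "\<dots> = (\<Sum>S\<in>\<F>. ?P {E. S \<subseteq> E \<and> N E = Suc m})"
      by (simp add: prob_random_subset_eq_sum[OF A])
    finally show ?thesis .
  qed
  then have "\<bar>real (Suc m) * a (Suc m) - card \<F> * p ^ e * a m\<bar> =
      \<bar>\<Sum>S\<in>\<F>. ?P {E. S \<subseteq> E \<and> N E = Suc m} - p ^ e * ?P {E. N E = m}\<bar>"
    by (simp add: a_def N_def sum_subtractf)
  also have "\<dots> \<le> (\<Sum>S\<in>\<F>. \<bar>?P {E. S \<subseteq> E \<and> N E = Suc m} - p ^ e * ?P {E. N E = m}\<bar>)"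
    by (rule sum_abs)
  also have "\<dots> \<le> (\<Sum>S\<in>\<F>. (\<Sum>T\<in>near S - {S}. p ^ card (S \<union> T)) + (\<Sum>T\<in>near S. p ^ (2 * e)))"
  proof (rule sum_mono)
    fix S assume S: "S \<in> \<F>"
    \<comment> \<open>Being nonempty, \<open>S\<close> belongs to \<open>near S\<close>; this
      supplies the successor in \<open>N E = Suc (N' S E)\<close>.\<close>
    have "S \<noteq> {}" using card[OF S] e by auto
    then have SS: "S \<in> near S" using S by (auto simp: near_def)
    have "\<bar>?P {E. S \<subseteq> E \<and> N E = Suc m} - ?P {E. S \<subseteq> E \<and> N' S E = m}\<bar> \<le>
        ?P {E. \<exists>U\<in>(\<union>) S ` (near S - {S}). U \<subseteq> E}"
    proof (rule abs_prob_diff_le)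
      have *: "N E = Suc (N' S E)" if "S \<subseteq> E" "E \<notin> {E. \<exists>U\<in>(\<union>) S ` (near S - {S}). U \<subseteq> E}" for E
      proof -
        have "{T \<in> near S. T \<subseteq> E} = {S}" using that SS by auto
        then show ?thesis using split[of E S] by simp
      qed
      show "{E. S \<subseteq> E \<and> N E = Suc m} - {E. \<exists>U\<in>(\<union>) S ` (near S - {S}). U \<subseteq> E} \<subseteq> {E. S \<subseteq> E \<and> N' S E = m}"
        using * by auto
      show "{E. S \<subseteq> E \<and> N' S E = m} - {E. \<exists>U\<in>(\<union>) S ` (near S - {S}). U \<subseteq> E} \<subseteq> {E. S \<subseteq> E \<and> N E = Suc m}"
        using * by auto
    qed
    also have "\<dots> \<le> (\<Sum>U\<in>(\<union>) S ` (near S - {S}). p ^ card U)"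
      using finn S sub p by (intro prob_exists_superset_le A) (auto simp: near_def)
    also have "\<dots> \<le> (\<Sum>T\<in>near S - {S}. p ^ card (S \<union> T))"
      using finn p by (intro sum_image_le[where g = "\<lambda>U. p ^ card U" and f = "(\<union>) S", unfolded o_def]) auto
    finally have 1: "\<bar>?P {E. S \<subseteq> E \<and> N E = Suc m} - ?P {E. S \<subseteq> E \<and> N' S E = m}\<bar> \<le>
        (\<Sum>T\<in>near S - {S}. p ^ card (S \<union> T))" .
    have inv: "N' S E = N' S (E - S)" for E
      unfolding N'_def by (rule arg_cong[where f = card]) (auto simp: near_def)
    have 2: "?P {E. S \<subseteq> E \<and> N' S E = m} = p ^ e * ?P {E. N' S E = m}"
      using prob_random_subset_superset_and[OF A sub[OF S] p, of "\<lambda>E. N' S E = m"] inv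
      by (simp add: card[OF S])
    have "\<bar>?P {E. N' S E = m} - ?P {E. N E = m}\<bar> \<le> ?P {E. \<exists>T\<in>near S. T \<subseteq> E}"
    proof (rule abs_prob_diff_le)
      have *: "N E = N' S E" if "E \<notin> {E. \<exists>T\<in>near S. T \<subseteq> E}" for E
      proof -
        have "{T \<in> near S. T \<subseteq> E} = {}" using that by auto
        then have "card {T \<in> near S. T \<subseteq> E} = 0" by (simp only: card.empty)
        then show ?thesis using split[of E S] by simp
      qed
      show "{E. N' S E = m} - {E. \<exists>T\<in>near S. T \<subseteq> E} \<subseteq> {E. N E = m}"
        "{E. N E = m} - {E. \<exists>T\<in>near S. T \<subseteq> E} \<subseteq> {E. N' S E = m}" using * by auto
    qed
    also have "\<dots> \<le> (\<Sum>T\<in>near S. p ^ card T)"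
      using finn sub p by (intro prob_exists_superset_le A) (auto simp: near_def)
    also have "\<dots> = (\<Sum>T\<in>near S. p ^ e)" by (intro sum.cong refl) (auto simp: near_def card)
    finally have "p ^ e * \<bar>?P {E. N' S E = m} - ?P {E. N E = m}\<bar> \<le> p ^ e * (\<Sum>T\<in>near S. p ^ e)"
      using p by (intro mult_left_mono) auto
    moreover have "p ^ e * (\<Sum>T\<in>near S. p ^ e) = (\<Sum>T\<in>near S. p ^ (2 * e))"
      by (simp add: mult_2 power_add)
    ultimately have 3: "\<bar>p ^ e * ?P {E. N' S E = m} - p ^ e * ?P {E. N E = m}\<bar> \<le> (\<Sum>T\<in>near S. p ^ (2 * e))"
      using p by (simp only: right_diff_distrib[symmetric] abs_mult abs_of_nonneg zero_le_power)
    show "\<bar>?P {E. S \<subseteq> E \<and> N E = Suc m} - p ^ e * ?P {E. N E = m}\<bar> \<le>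
        (\<Sum>T\<in>near S - {S}. p ^ card (S \<union> T)) + (\<Sum>T\<in>near S. p ^ (2 * e))"
      using 1 2 3 by linarith
  qed
  also have "\<dots> = (\<Sum>S\<in>\<F>. \<Sum>T\<in>{T \<in> \<F>. T \<noteq> S \<and> T \<inter> S \<noteq> {}}. p ^ card (S \<union> T)) +
    (\<Sum>S\<in>\<F>. \<Sum>T\<in>{T \<in> \<F>. T \<inter> S \<noteq> {}}. p ^ (2 * e))"
    unfolding sum.distrib
    by (intro arg_cong2[where f = "(+)"] sum.cong refl) (auto simp: near_def)
  finally show ?thesis .
qed

text \<open>Markov's inequality: by linearity the mean count is
  \<open>card \<F> * p ^ e\<close>.\<close>

lemma prob_count_ge_le:
  fixes A :: "'a set" and p :: real
  assumes A: "finite A" and fin: "finite \<F>" and sub: "\<And>S. S \<in> \<F> \<Longrightarrow> S \<subseteq> A"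
    and card: "\<And>S. S \<in> \<F> \<Longrightarrow> card S = e" and p: "0 \<le> p" "p \<le> 1" and M: "0 < M"
  shows "measure_pmf.prob (random_subset A p) {E. M \<le> card {S \<in> \<F>. S \<subseteq> E}} \<le> card \<F> * p ^ e / M"
proof -
  let ?P = "measure_pmf.prob (random_subset A p)"
  have "M * ?P {E. M \<le> card {S \<in> \<F>. S \<subseteq> E}} =
      (\<Sum>E\<in>Pow A. pmf (random_subset A p) E * (M * of_bool (M \<le> card {S \<in> \<F>. S \<subseteq> E})))"
    by (simp add: prob_random_subset_eq_sum[OF A] sum_distrib_left mult_ac)
  also have "\<dots> \<le> (\<Sum>E\<in>Pow A. pmf (random_subset A p) E * (\<Sum>S\<in>\<F>. of_bool (S \<subseteq> E)))"
  proof (intro sum_mono mult_left_mono)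
    fix E
    have "(\<Sum>S\<in>\<F>. of_bool (S \<subseteq> E)) = real (card {S \<in> \<F>. S \<subseteq> E})"
      using fin by (simp add: of_bool_def sum.If_cases Int_def)
    then show "M * of_bool (M \<le> card {S \<in> \<F>. S \<subseteq> E}) \<le> (\<Sum>S\<in>\<F>. of_bool (S \<subseteq> E) :: real)"
      by auto
  qed auto
  also have "\<dots> = (\<Sum>S\<in>\<F>. \<Sum>E\<in>Pow A. pmf (random_subset A p) E * of_bool (S \<subseteq> E))"
    unfolding sum_distrib_left by (rule sum.swap)
  also have "\<dots> = (\<Sum>S\<in>\<F>. ?P {E. S \<subseteq> E})" by (simp add: prob_random_subset_eq_sum[OF A])
  also have "\<dots> = (\<Sum>S\<in>\<F>. p ^ e)"
    using A sub p card by (intro sum.cong refl) (simp add: prob_random_subset_superset)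
  also have "\<dots> = card \<F> * p ^ e" by simp
  finally show ?thesis using M by (simp add: field_simps)
qed

section \<open>Overlapping copies of a strictly balanced graph\<close>

lemma finite_Union_card2:
  assumes "finite F" "\<forall>e\<in>F. card e = 2"
  shows "finite (\<Union>F)"
  using assms by (intro finite_Union) (auto intro!: card_ge_0_finite)

lemma copies_iff:
  "S \<in> copies F V \<longleftrightarrow> (\<exists>\<sigma>. inj_on \<sigma> (\<Union>F) \<and> \<sigma> ` \<Union>F \<subseteq> V \<and> S = (`) \<sigma> ` F)"
  unfolding copies_def mem_Collect_eq by (intro iff_exI) (simp only: conj_ac)

lemma Union_image_image: "\<Union>((`) \<sigma> ` F) = \<sigma> ` \<Union>F"
  by (simp only: image_Union)

lemma copies_card:
  assumes "S \<in> copies F V"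
  shows "card S = card F" "card (\<Union>S) = card (\<Union>F)" "\<Union>S \<subseteq> V"
proof -
  obtain \<sigma> where \<sigma>: "inj_on \<sigma> (\<Union>F)" "\<sigma> ` \<Union>F \<subseteq> V" "S = (`) \<sigma> ` F"
    using assms unfolding copies_iff by (elim exE conjE)
  show "card S = card F" unfolding \<sigma>(3) by (rule card_image[OF inj_on_image[OF \<sigma>(1)]])
  show "card (\<Union>S) = card (\<Union>F)" unfolding \<sigma>(3) Union_image_image by (rule card_image[OF \<sigma>(1)])
  show "\<Union>S \<subseteq> V" unfolding \<sigma>(3) Union_image_image by (rule \<sigma>(2))
qed

lemma copies_subset_vertex_pairs:
  assumes "S \<in> copies F V" "\<forall>e\<in>F. card e = 2"
  shows "S \<subseteq> vertex_pairs V"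
proof -
  obtain \<sigma> where \<sigma>: "inj_on \<sigma> (\<Union>F)" "\<sigma> ` \<Union>F \<subseteq> V" "S = (`) \<sigma> ` F"
    using assms unfolding copies_iff by (elim exE conjE)
  have "\<sigma> ` e \<subseteq> V \<and> card (\<sigma> ` e) = 2" if "e \<in> F" for e
  proof
    have e: "e \<subseteq> \<Union>F" using that by auto
    then show "\<sigma> ` e \<subseteq> V" using \<sigma>(2) by (meson image_mono order_trans)
    show "card (\<sigma> ` e) = 2" using card_image[OF inj_on_subset[OF \<sigma>(1) e]] assms(2) that by simp
  qed
  then show ?thesis unfolding \<sigma>(3) vertex_pairs_def by (simp add: image_subset_iff)
qed

lemma strictly_balanced_copy:
  assumes F: "strictly_balanced F" and S: "S \<in> copies F V" and K: "K \<subset> S" "K \<noteq> {}"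
  shows "card K * card (\<Union>F) < card F * card (\<Union>K)"
proof -
  obtain \<sigma> where \<sigma>: "inj_on \<sigma> (\<Union>F)" "\<sigma> ` \<Union>F \<subseteq> V" "S = (`) \<sigma> ` F"
    using S unfolding copies_iff by (elim exE conjE)
  obtain F' where F': "F' \<subseteq> F" "K = (`) \<sigma> ` F'" using K(1) \<sigma>(3) by (meson psubset_imp_subset subset_imageE)
  have "F' \<noteq> F" "F' \<noteq> {}" using K F'(2) \<sigma>(3) by auto
  then have "card F' * card (\<Union>F) < card F * card (\<Union>F')"
    using F F'(1) unfolding strictly_balanced_def by blast
  moreover have sub: "\<Union>F' \<subseteq> \<Union>F" using F'(1) by auto
  have "card K = card F'"
    unfolding F'(2) by (rule card_image[OF inj_on_image[OF inj_on_subset[OF \<sigma>(1) sub]]])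
  moreover have "card (\<Union>K) = card (\<Union>F')"
    unfolding F'(2) Union_image_image by (rule card_image[OF inj_on_subset[OF \<sigma>(1) sub]])
  ultimately show ?thesis by simp
qed

text \<open>The map \<open>\<rho>\<close> records which vertex of \<open>F\<close> sits at each
  point of \<open>U\<close>, and \<open>\<tau>\<close> places the remaining vertices anywhere in
  \<open>V\<close>. Since \<open>\<tau>\<close> may fail to be injective, \<open>H \<rho>\<close>
  can contain sets that are not copies, which is harmless for an upper bound.\<close>

lemma card_copies_containing_le:
  assumes fin: "finite V" "finite (\<Union>F)" and U: "finite U"
  shows "card {T \<in> copies F V. U \<subseteq> \<Union>T} \<le> card (\<Union>F) ^ card U * card V ^ (card (\<Union>F) - card U)"
proof -
  define W where "W = \<Union>F"
  define R where "R = {\<rho> \<in> U \<rightarrow>\<^sub>E W. inj_on \<rho> U}"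
  define ext where "ext \<rho> \<tau> x = (if x \<in> \<rho> ` U then inv_into U \<rho> x else \<tau> x)" for \<rho> :: "'a \<Rightarrow> 'b" and \<tau> x
  define H where "H \<rho> = (\<lambda>\<tau>. (`) (ext \<rho> \<tau>) ` F) ` ((W - \<rho> ` U) \<rightarrow>\<^sub>E V)" for \<rho>
  have fR: "finite R" unfolding R_def using U fin by (simp add: W_def finite_PiE)
  have "{T \<in> copies F V. U \<subseteq> \<Union>T} \<subseteq> (\<Union>\<rho>\<in>R. H \<rho>)"
  proof
    fix T assume "T \<in> {T \<in> copies F V. U \<subseteq> \<Union>T}"
    then obtain \<sigma> where \<sigma>: "inj_on \<sigma> W" "\<sigma> ` W \<subseteq> V" "T = (`) \<sigma> ` F" and "U \<subseteq> \<Union>T"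
      unfolding W_def mem_Collect_eq copies_iff by (elim exE conjE)
    then have US: "U \<subseteq> \<sigma> ` W" by (simp only: Union_image_image W_def)
    define \<rho> where "\<rho> = restrict (inv_into W \<sigma>) U"
    have \<rho>W: "\<rho> u \<in> W" "\<sigma> (\<rho> u) = u" if "u \<in> U" for u
      using US that by (auto simp: \<rho>_def inv_into_into f_inv_into_f subset_iff)
    have inj: "inj_on \<rho> U" using \<rho>W by (metis inj_onI)
    then have "\<rho> \<in> R" using \<rho>W by (auto simp: R_def \<rho>_def)
    moreover have "T \<in> H \<rho>"
    proof -
      define \<tau> where "\<tau> = restrict \<sigma> (W - \<rho> ` U)"
      have "\<tau> \<in> (W - \<rho> ` U) \<rightarrow>\<^sub>E V" using \<sigma>(2) by (auto simp: \<tau>_def)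
      moreover have "ext \<rho> \<tau> x = \<sigma> x" if "x \<in> W" for x
      proof (cases "x \<in> \<rho> ` U")
        case True
        then obtain u where "u \<in> U" "x = \<rho> u" by auto
        then show ?thesis using inj \<rho>W True by (simp add: ext_def)
      qed (use that in \<open>auto simp: ext_def \<tau>_def\<close>)
      then have "ext \<rho> \<tau> ` e = \<sigma> ` e" if "e \<in> F" for e
        using that by (intro image_cong refl) (auto simp: W_def)
      then have "T = (`) (ext \<rho> \<tau>) ` F" unfolding \<sigma>(3) by (rule image_cong[OF refl, symmetric])
      ultimately show ?thesis unfolding H_def by - (rule image_eqI[where x = \<tau>])
    qed
    ultimately show "T \<in> (\<Union>\<rho>\<in>R. H \<rho>)" by blast
  qed
  moreover have fH: "finite (H \<rho>)" for \<rho> unfolding H_def using fin by (simp add: W_def finite_PiE)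
  ultimately have "card {T \<in> copies F V. U \<subseteq> \<Union>T} \<le> card (\<Union>\<rho>\<in>R. H \<rho>)"
    using fR by (intro card_mono) auto
  also have "\<dots> \<le> (\<Sum>\<rho>\<in>R. card (H \<rho>))" using fR by (rule card_UN_le)
  also have "\<dots> \<le> (\<Sum>\<rho>\<in>R. card V ^ (card W - card U))"
  proof (rule sum_mono)
    fix \<rho> assume "\<rho> \<in> R"
    then have "inj_on \<rho> U" "\<rho> ` U \<subseteq> W" by (auto simp: R_def)
    then have "card (W - \<rho> ` U) = card W - card U"
      using U by (simp add: card_Diff_subset card_image)
    moreover have "card (H \<rho>) \<le> card ((W - \<rho> ` U) \<rightarrow>\<^sub>E V)"
      unfolding H_def using fin by (intro card_image_le finite_PiE) (auto simp: W_def)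
    ultimately show "card (H \<rho>) \<le> card V ^ (card W - card U)"
      using fin by (simp add: card_PiE W_def)
  qed
  also have "\<dots> = card R * card V ^ (card W - card U)" by simp
  also have "\<dots> \<le> card W ^ card U * card V ^ (card W - card U)"
  proof (rule mult_le_mono1)
    have "card R \<le> card (U \<rightarrow>\<^sub>E W)"
      unfolding R_def using U fin by (intro card_mono finite_PiE) (auto simp: W_def)
    then show "card R \<le> card W ^ card U" using U by (simp add: card_PiE)
  qed
  finally show ?thesis by (simp add: W_def)
qed

lemma card_copies_le:
  assumes "finite V" "finite (\<Union>F)"
  shows "card (copies F V) \<le> card V ^ card (\<Union>F)"
  using card_copies_containing_le[OF assms, of "{}"] by simp

text \<open>Every vertex set of the right size carries a copy, and the copy determines the set. The
  power bound on the binomial coefficient is multiplied out to avoid a division.\<close>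

lemma card_copies_ge:
  assumes fin: "finite V" "finite (\<Union>F)" and le: "card (\<Union>F) \<le> card V" "0 < card (\<Union>F)"
  shows "real (card V) ^ card (\<Union>F) \<le> card (\<Union>F) ^ card (\<Union>F) * real (card (copies F V))"
proof -
  let ?v = "card (\<Union>F)"
  have "{U. U \<subseteq> V \<and> card U = ?v} \<subseteq> Union ` copies F V"
  proof
    fix U assume "U \<in> {U. U \<subseteq> V \<and> card U = ?v}"
    then have U: "U \<subseteq> V" "card U = ?v" by auto
    then obtain \<sigma> where \<sigma>: "bij_betw \<sigma> (\<Union>F) U"
      using fin by (metis finite_same_card_bij finite_subset)
    have "(`) \<sigma> ` F \<in> copies F V"
      unfolding copies_iff using \<sigma> U by (intro exI[of _ \<sigma>]) (simp add: bij_betw_def)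
    moreover have "U = \<Union>((`) \<sigma> ` F)" using \<sigma> by (simp only: Union_image_image bij_betw_def)
    ultimately show "U \<in> Union ` copies F V" by (rule rev_image_eqI)
  qed
  then have "card {U. U \<subseteq> V \<and> card U = ?v} \<le> card (copies F V)"
    using finite_copies[OF fin(1)] by (meson card_image_le card_mono finite_imageI order_trans)
  then have "real (card V choose ?v) \<le> card (copies F V)" using fin by (simp add: n_subsets)
  moreover have "(real (card V) / real ?v) ^ ?v \<le> real (card V choose ?v)"
    using binomial_ge_n_over_k_pow_k[OF le(1), where ?'a = real] by simp
  ultimately have "(real (card V) / real ?v) ^ ?v \<le> card (copies F V)" by linarith
  then show ?thesis using le(2) by (simp add: power_divide field_simps)
qed

text \<open>Writing \<open>K = S \<inter> T\<close>, the pairs \<open>(S, T)\<close> contribute \<open>\<mu>\<^sup>2 / (n^v(K) p^e(K))\<close> up to a constant, and strict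
  balance makes the denominator at least \<open>n^(1/e)\<close>.\<close>

lemma overlap_sum_le:
  fixes F :: "'a set set" and V :: "'b set" and p \<mu> B :: real
  defines "v \<equiv> card (\<Union>F)" and "e \<equiv> card F" and "n \<equiv> card V"
  assumes F: "strictly_balanced F" and V: "finite V" "v \<le> n" and \<mu>: "1 \<le> \<mu>"
    and p: "0 < p" "p \<le> 1" "real (card (copies F V)) * p ^ e = \<mu>"
    and B: "0 < B" "B ^ e \<le> real n"
  shows "(\<Sum>S\<in>copies F V. \<Sum>T\<in>{T \<in> copies F V. T \<noteq> S \<and> T \<inter> S \<noteq> {}}. p ^ card (S \<union> T))
    \<le> \<mu>\<^sup>2 * 2 ^ e * real (v ^ (2 * v)) / B"
proof -
  have F': "finite F" "F \<noteq> {}" "\<forall>e\<in>F. card e = 2" using F by (auto simp: strictly_balanced_def)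
  have finU: "finite (\<Union>F)" using F' finite_Union_card2 by blast
  have e: "0 < e" using F' by (simp add: e_def card_gt_0_iff)
  have "\<Union>F \<noteq> {}" using F' by fastforce
  then have v: "0 < v" using finU by (simp add: v_def card_gt_0_iff)
  then have n: "0 < real n" using V by simp
  let ?C = "copies F V"
  have finC: "finite ?C" using finite_copies[OF V(1)] .
  have Ssub: "finite S" "card S = e" "finite (\<Union>S)" "card (\<Union>S) = v" "\<Union>S \<subseteq> V" if "S \<in> ?C" for S
  proof -
    show "card S = e" "card (\<Union>S) = v" "\<Union>S \<subseteq> V" using copies_card[OF that] by (auto simp: e_def v_def)
    then show "finite S" "finite (\<Union>S)" using e v by (auto intro: card_ge_0_finite)
  qed
  have np: "real n ^ v * p ^ e \<le> v ^ v * \<mu>"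
  proof -
    have "real n ^ v * p ^ e \<le> v ^ v * real (card ?C) * p ^ e"
      using card_copies_ge[OF V(1) finU] V(2) v p(1) unfolding v_def n_def
      by (intro mult_right_mono) auto
    also have "\<dots> = v ^ v * \<mu>" using p(3) by (simp add: mult.assoc)
    finally show ?thesis .
  qed
  have pe: "\<mu> \<le> real n ^ v * p ^ e"
  proof -
    have "real (card ?C) \<le> real n ^ v"
      using card_copies_le[OF V(1) finU] unfolding v_def n_def by (metis of_nat_le_iff of_nat_power)
    then show ?thesis unfolding p(3)[symmetric] using p(1) by (intro mult_right_mono) auto
  qed
  \<comment> \<open>With \<open>u\<close> vertices and \<open>k\<close> edges in \<open>K\<close>,
    strict balance in integers reads \<open>v * k + 1 \<le> e * u\<close>. The 1 yields the factor
    \<open>n\<close> in \<open>(n^u * p^k)^e \<ge> n * (n^v * p^e)^k \<ge> n\<close>. Comparing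
    powers with exponent \<open>e\<close> avoids real roots.\<close>
  have dense: "B \<le> real n ^ card (\<Union>K) * p ^ card K" if S: "S \<in> ?C" and K: "K \<subset> S" "K \<noteq> {}" for S K
  proof -
    let ?u = "card (\<Union>K)" and ?k = "card K"
    have less: "v * ?k < e * ?u"
      using strictly_balanced_copy[OF F S K] by (simp add: v_def e_def mult.commute)
    have "real n * 1 \<le> real n * \<mu> ^ ?k"
      using n \<mu> by (intro mult_left_mono one_le_power) auto
    also have "\<dots> \<le> real n * (real n ^ v * p ^ e) ^ ?k"
      using n pe \<mu> by (intro mult_left_mono power_mono) auto
    also have "\<dots> = real n ^ Suc (v * ?k) * (p ^ ?k) ^ e"
      by (simp add: power_mult_distrib power_mult[symmetric] mult.commute)
    also have "\<dots> \<le> real n ^ (e * ?u) * (p ^ ?k) ^ e"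
      using n p(1) less by (intro mult_right_mono power_increasing) auto
    also have "\<dots> = (real n ^ ?u * p ^ ?k) ^ e"
      by (simp add: power_mult_distrib power_mult[symmetric] mult.commute)
    finally have "B ^ e \<le> (real n ^ ?u * p ^ ?k) ^ e" using B by simp
    then show ?thesis using e n p(1) by (meson B(1) less_imp_le mult_nonneg_nonneg power_mono_iff zero_le_power)
  qed
  \<comment> \<open>At most \<open>v ^ v * n ^ (v - u)\<close> copies pass through \<open>K\<close>,
    and \<open>n ^ (v - u) * p ^ (2 * e - k)\<close> is \<open>n ^ v * p ^ (2 * e)\<close> divided
    by the quantity that \<open>dense\<close> bounds from below.\<close>
  have core: "(\<Sum>T\<in>{T \<in> ?C. K \<subseteq> T}. p ^ (2 * e - card K)) \<le> v ^ v * (v ^ v * \<mu> * p ^ e / B)"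
    if S: "S \<in> ?C" and K: "K \<subset> S" "K \<noteq> {}" for S K
  proof -
    let ?u = "card (\<Union>K)" and ?k = "card K"
    have KS: "\<Union>K \<subseteq> \<Union>S" using K by auto
    then have fK: "finite (\<Union>K)" "?u \<le> v"
      using Ssub[OF S] by (auto intro: finite_subset card_mono[of "\<Union>S" "\<Union>K", simplified])
    have k: "?k \<le> e" using Ssub[OF S] K card_mono[of S K] by auto
    have "card {T \<in> ?C. K \<subseteq> T} \<le> card {T \<in> ?C. \<Union>K \<subseteq> \<Union>T}"
      using finC by (intro card_mono) auto
    also have "\<dots> \<le> v ^ ?u * n ^ (v - ?u)"
      using card_copies_containing_le[OF V(1) finU fK(1)] by (simp add: v_def n_def)
    also have "\<dots> \<le> v ^ v * n ^ (v - ?u)" using v fK by (intro mult_le_mono1 power_increasing) auto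
    finally have "real (card {T \<in> ?C. K \<subseteq> T}) \<le> real (v ^ v * n ^ (v - ?u))" by (rule of_nat_mono)
    then have "(\<Sum>T\<in>{T \<in> ?C. K \<subseteq> T}. p ^ (2 * e - ?k)) \<le> real (v ^ v * n ^ (v - ?u)) * p ^ (2 * e - ?k)"
      using p(1) by (simp add: mult_right_mono del: of_nat_mult of_nat_power)
    also have "\<dots> = v ^ v * (real n ^ (v - ?u) * p ^ (2 * e - ?k))" by simp
    also have "\<dots> \<le> v ^ v * (v ^ v * \<mu> * p ^ e / B)"
    proof (intro mult_left_mono)
      let ?x = "real n ^ (v - ?u) * p ^ (2 * e - ?k)"
      have "?x * B \<le> ?x * (real n ^ ?u * p ^ ?k)"
        using dense[OF S K] n p(1) by (intro mult_left_mono) auto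
      also have "\<dots> = (real n ^ (v - ?u) * real n ^ ?u) * (p ^ (2 * e - ?k) * p ^ ?k)" by (simp add: mult_ac)
      also have "\<dots> = real n ^ v * p ^ (e + e)" using fK k by (simp add: power_add[symmetric] mult_2)
      also have "\<dots> = real n ^ v * p ^ e * p ^ e" by (simp add: power_add)
      also have "\<dots> \<le> v ^ v * \<mu> * p ^ e" using np p(1) by (intro mult_right_mono) auto
      finally show "?x \<le> v ^ v * \<mu> * p ^ e / B" using B(1) by (simp add: field_simps)
    qed auto
    finally show ?thesis .
  qed
  \<comment> \<open>All copies have \<open>e\<close> edges, so \<open>S\<close> meets a different
    copy in a proper subset \<open>K\<close>. There are at most \<open>2 ^ e\<close> choices for
    it.\<close>
  have inner: "(\<Sum>T\<in>{T \<in> ?C. T \<noteq> S \<and> T \<inter> S \<noteq> {}}. p ^ card (S \<union> T)) \<le> 2 ^ e * (v ^ v * (v ^ v * \<mu> * p ^ e / B))"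
    if S: "S \<in> ?C" for S
  proof -
    let ?N = "{T \<in> ?C. T \<noteq> S \<and> T \<inter> S \<noteq> {}}"
    let ?\<K> = "{K. K \<subset> S \<and> K \<noteq> {}}"
    have fin\<K>: "finite ?\<K>" using Ssub(1)[OF S] by (rule finite_subset[rotated, OF finite_Pow_iff[THEN iffD2]]) auto
    have card\<K>: "card ?\<K> \<le> 2 ^ e"
      using card_mono[of "Pow S" ?\<K>] Ssub[OF S] by (auto simp: card_Pow)
    have sub: "?N \<subseteq> (\<Union>K\<in>?\<K>. {T \<in> ?C. S \<inter> T = K})"
    proof
      fix T assume T: "T \<in> ?N"
      have "S \<inter> T \<noteq> S"
      proof
        assume "S \<inter> T = S"
        then have "S \<subseteq> T" by auto
        then have "S = T" using T Ssub[OF S] Ssub[of T] by (intro card_subset_eq) auto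
        then show False using T by auto
      qed
      then show "T \<in> (\<Union>K\<in>?\<K>. {T \<in> ?C. S \<inter> T = K})" using T by auto
    qed
    have "(\<Sum>T\<in>?N. p ^ card (S \<union> T)) \<le> (\<Sum>T\<in>(\<Union>K\<in>?\<K>. {T \<in> ?C. S \<inter> T = K}). p ^ card (S \<union> T))"
      using p(1) fin\<K> finC by (intro sum_mono2[OF _ sub]) auto
    also have "\<dots> = (\<Sum>K\<in>?\<K>. \<Sum>T\<in>{T \<in> ?C. S \<inter> T = K}. p ^ card (S \<union> T))"
      using fin\<K> finC by (intro sum.UNION_disjoint) auto
    also have "\<dots> \<le> (\<Sum>K\<in>?\<K>. \<Sum>T\<in>{T \<in> ?C. K \<subseteq> T}. p ^ (2 * e - card K))"
    proof (rule sum_mono)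
      fix K assume "K \<in> ?\<K>"
      have "(\<Sum>T\<in>{T \<in> ?C. S \<inter> T = K}. p ^ card (S \<union> T)) = (\<Sum>T\<in>{T \<in> ?C. S \<inter> T = K}. p ^ (2 * e - card K))"
      proof (intro sum.cong refl)
        fix T assume T: "T \<in> {T \<in> ?C. S \<inter> T = K}"
        then have "card (S \<union> T) = 2 * e - card K"
          using Ssub[OF S] Ssub[of T] card_Un_Int[of S T] by auto
        then show "p ^ card (S \<union> T) = p ^ (2 * e - card K)" by simp
      qed
      also have "\<dots> \<le> (\<Sum>T\<in>{T \<in> ?C. K \<subseteq> T}. p ^ (2 * e - card K))"
        using p(1) finC by (intro sum_mono2) auto
      finally show "(\<Sum>T\<in>{T \<in> ?C. S \<inter> T = K}. p ^ card (S \<union> T)) \<le> (\<Sum>T\<in>{T \<in> ?C. K \<subseteq> T}. p ^ (2 * e - card K))" .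
    qed
    also have "\<dots> \<le> (\<Sum>K\<in>?\<K>. v ^ v * (v ^ v * \<mu> * p ^ e / B))"
      using core[OF S] by (intro sum_mono) auto
    also have "\<dots> = card ?\<K> * (v ^ v * (v ^ v * \<mu> * p ^ e / B))" by simp
    also have "\<dots> \<le> 2 ^ e * (v ^ v * (v ^ v * \<mu> * p ^ e / B))"
    proof (rule mult_right_mono)
      show "real (card ?\<K>) \<le> 2 ^ e" using card\<K> by (metis of_nat_le_iff of_nat_numeral of_nat_power)
    qed (use \<mu> p(1) B(1) in auto)
    finally show ?thesis .
  qed
  have "(\<Sum>S\<in>?C. \<Sum>T\<in>{T \<in> ?C. T \<noteq> S \<and> T \<inter> S \<noteq> {}}. p ^ card (S \<union> T))
      \<le> (\<Sum>S\<in>?C. 2 ^ e * (v ^ v * (v ^ v * \<mu> * p ^ e / B)))"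
    using inner by (rule sum_mono)
  also have "\<dots> = (card ?C * p ^ e) * (2 ^ e * (v ^ v * (v ^ v * \<mu> / B)))" by simp
  also have "\<dots> = \<mu>\<^sup>2 * 2 ^ e * real (v ^ (2 * v)) / B"
    unfolding p(3) by (simp add: power2_eq_square mult_2 power_add)
  finally show ?thesis .
qed

section \<open>Distinguishing two random graphs\<close>

lemma finite_vertex_pairs: "finite V \<Longrightarrow> finite (vertex_pairs V)"
  by (rule finite_subset[of _ "Pow V"]) (auto simp: vertex_pairs_def)

lemma random_graph_eq_map_random_subset:
  "random_graph n p =
     map_pmf (\<lambda>E. \<lparr>verts = {1..n}, edges = E\<rparr>) (random_subset (vertex_pairs {1..n}) p)"
  by (simp add: random_graph_def random_subset_def pmf.map_comp o_def)

lemma prob_random_graph_count_copies: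
  "measure_pmf.prob (random_graph n p) {G. P (count_copies F G)} =
   measure_pmf.prob (random_subset (vertex_pairs {1..n}) p) {E. P (card {S \<in> copies F {1..n}. S \<subseteq> E})}"
  by (simp add: random_graph_eq_map_random_subset count_copies_def vimage_def)

text \<open>As \<open>card (S \<union> T) \<le> 2 * e\<close> and \<open>p \<le> 1\<close>, the
  second sum is dominated by the first, up to its diagonal \<open>T = S\<close>. The diagonal
  amounts to \<open>\<mu> * p ^ e\<close>, which is small because
  \<open>n * p ^ e \<le> n ^ v * p ^ e \<le> v ^ v * \<mu>\<close>.\<close>

lemma recursion_error_le:
  fixes F :: "'a set set" and V :: "'b set" and p \<mu> B :: real
  defines "v \<equiv> card (\<Union>F)" and "e \<equiv> card F" and "n \<equiv> card V"
  assumes F: "strictly_balanced F" and V: "finite V" "v \<le> n" and \<mu>: "1 \<le> \<mu>"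
    and p: "0 < p" "p \<le> 1" "real (card (copies F V)) * p ^ e = \<mu>"
    and B: "0 < B" "B ^ e \<le> real n"
  shows "(\<Sum>S\<in>copies F V. \<Sum>T\<in>{T \<in> copies F V. T \<noteq> S \<and> T \<inter> S \<noteq> {}}. p ^ card (S \<union> T)) +
    (\<Sum>S\<in>copies F V. \<Sum>T\<in>{T \<in> copies F V. T \<inter> S \<noteq> {}}. p ^ (2 * e))
    \<le> 2 * (\<mu>\<^sup>2 * 2 ^ e * real (v ^ (2 * v)) / B) + \<mu>\<^sup>2 * real (v ^ v) / n"
proof -
  let ?C = "copies F V"
  let ?N = "\<lambda>S. {T \<in> ?C. T \<noteq> S \<and> T \<inter> S \<noteq> {}}"
  have F': "finite F" "F \<noteq> {}" "\<forall>e\<in>F. card e = 2" using F by (auto simp: strictly_balanced_def)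
  have finU: "finite (\<Union>F)" using F' finite_Union_card2 by blast
  have "\<Union>F \<noteq> {}" using F' by fastforce
  then have v: "0 < v" using finU by (simp add: v_def card_gt_0_iff)
  then have n: "1 \<le> real n" using V by linarith
  have finC: "finite ?C" using finite_copies[OF V(1)] .
  define \<Sigma> where "\<Sigma> = (\<Sum>S\<in>?C. \<Sum>T\<in>?N S. p ^ card (S \<union> T))"
  have "(\<Sum>S\<in>?C. \<Sum>T\<in>{T \<in> ?C. T \<inter> S \<noteq> {}}. p ^ (2 * e)) \<le> (\<Sum>S\<in>?C. p ^ (2 * e) + (\<Sum>T\<in>?N S. p ^ card (S \<union> T)))"
  proof (rule sum_mono)
    fix S assume S: "S \<in> ?C"
    have "(\<Sum>T\<in>{T \<in> ?C. T \<inter> S \<noteq> {}}. p ^ (2 * e)) \<le> (\<Sum>T\<in>insert S (?N S). p ^ (2 * e))"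
      using p finC by (intro sum_mono2) auto
    also have "\<dots> = p ^ (2 * e) + (\<Sum>T\<in>?N S. p ^ (2 * e))" using finC by (subst sum.insert) auto
    also have "\<dots> \<le> p ^ (2 * e) + (\<Sum>T\<in>?N S. p ^ card (S \<union> T))"
    proof (intro add_left_mono sum_mono)
      fix T assume "T \<in> ?N S"
      then have "card (S \<union> T) \<le> 2 * e"
        using copies_card(1)[OF S] copies_card(1)[of T F V] card_Un_le[of S T] by (auto simp: e_def)
      then show "p ^ (2 * e) \<le> p ^ card (S \<union> T)" using p by (intro power_decreasing) auto
    qed
    finally show "(\<Sum>T\<in>{T \<in> ?C. T \<inter> S \<noteq> {}}. p ^ (2 * e)) \<le> p ^ (2 * e) + (\<Sum>T\<in>?N S. p ^ card (S \<union> T))" .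
  qed
  also have "\<dots> = card ?C * p ^ e * p ^ e + \<Sigma>" by (simp add: sum.distrib \<Sigma>_def mult_2 power_add)
  also have "\<dots> = \<mu> * p ^ e + \<Sigma>" unfolding p(3) ..
  finally have second: "(\<Sum>S\<in>?C. \<Sum>T\<in>{T \<in> ?C. T \<inter> S \<noteq> {}}. p ^ (2 * e)) \<le> \<mu> * p ^ e + \<Sigma>" .
  have "real n * p ^ e \<le> real n ^ v * p ^ e"
    using n v p(1) self_le_power[of "real n" v] by (intro mult_right_mono) auto
  also have "\<dots> \<le> v ^ v * real (card ?C) * p ^ e"
    using card_copies_ge[OF V(1) finU] V(2) v p(1) unfolding v_def n_def
    by (intro mult_right_mono) auto
  also have "\<dots> = v ^ v * \<mu>" using p(3) by (simp add: mult.assoc)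
  finally have "p ^ e \<le> v ^ v * \<mu> / n" using n by (simp add: field_simps)
  then have "\<mu> * p ^ e \<le> \<mu> * (v ^ v * \<mu> / n)" using \<mu> by (intro mult_left_mono) auto
  also have "\<dots> = \<mu>\<^sup>2 * real (v ^ v) / n" by (simp add: power2_eq_square)
  finally have "\<mu> * p ^ e \<le> \<mu>\<^sup>2 * real (v ^ v) / n" .
  moreover have "\<Sigma> \<le> \<mu>\<^sup>2 * 2 ^ e * real (v ^ (2 * v)) / B"
    unfolding \<Sigma>_def v_def e_def
    using overlap_sum_le[OF F V(1) _ \<mu> p(1,2) _ B(1)] V(2) p(3) B(2) unfolding v_def e_def n_def by blast
  ultimately show ?thesis using second unfolding \<Sigma>_def by linarith
qed

text \<open>The mean \<open>\<mu>\<close> and the tolerance \<open>\<eta>\<close> are fixed by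
  \<open>\<epsilon>\<close> before \<open>n\<close> enters. The recursion error is bounded
  independently of the count \<open>m\<close> and drops below \<open>\<eta>\<close> for large
  \<open>n\<close>.\<close>

lemma count_copies_anticoncentration:
  fixes F :: "'a set set" and \<epsilon> :: real
  assumes F: "strictly_balanced F" and \<epsilon>: "0 < \<epsilon>"
  obtains \<mu> :: real and n\<^sub>0 :: nat where "1 \<le> \<mu>"
    "\<And>n p m. n\<^sub>0 \<le> n \<Longrightarrow> 0 < p \<Longrightarrow> p \<le> 1 \<Longrightarrow> real (card (copies F {1..n})) * p ^ card F = \<mu> \<Longrightarrow>
      measure_pmf.prob (random_graph n p) {G. count_copies F G = m} \<le> \<epsilon>"
proof -
  define v where "v = card (\<Union>F)"
  define e where "e = card F"
  have F': "finite F" "F \<noteq> {}" "\<forall>e\<in>F. card e = 2" using F by (auto simp: strictly_balanced_def)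
  have finU: "finite (\<Union>F)" using F' finite_Union_card2 by blast
  have "\<Union>F \<noteq> {}" using F' by fastforce
  then have v: "0 < v" using finU by (simp add: v_def card_gt_0_iff)
  have e: "0 < e" using F' by (simp add: e_def card_gt_0_iff)
  obtain \<mu> \<eta> :: real where \<mu>: "1 \<le> \<mu>" and \<eta>: "0 < \<eta>" and anti:
    "\<And>(a :: nat \<Rightarrow> real) m. (\<And>I. finite I \<Longrightarrow> sum a I \<le> 1) \<Longrightarrow> (\<And>j. 0 \<le> a j) \<Longrightarrow>
      (\<And>j. \<bar>real (Suc j) * a (Suc j) - \<mu> * a j\<bar> \<le> \<eta>) \<Longrightarrow> a m \<le> \<epsilon>"
    using approx_poisson_anticoncentration[OF \<epsilon>] by blast
  \<comment> \<open>The overlap bound enters twice, each time as \<open>\<eta> / 4\<close>. The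
    other half of \<open>\<eta>\<close> is left for the diagonal term, controlled by the third
    summand in the choice of \<open>n\<^sub>0\<close>.\<close>
  define B where "B = 4 * (\<mu>\<^sup>2 * 2 ^ e * real (v ^ (2 * v))) / \<eta>"
  have B: "0 < B" using \<mu> \<eta> v by (simp add: B_def)
  obtain n\<^sub>0 where n0: "real v + B ^ e + 2 * (\<mu>\<^sup>2 * real (v ^ v)) / \<eta> + 1 < real n\<^sub>0"
    using reals_Archimedean2 by blast
  have "measure_pmf.prob (random_graph n p) {G. count_copies F G = m} \<le> \<epsilon>"
    if n: "n\<^sub>0 \<le> n" and p: "0 < p" "p \<le> 1" "real (card (copies F {1..n})) * p ^ card F = \<mu>" for n p m
  proof -
    define D where "D = random_subset (vertex_pairs {1..n}) p"
    define h where "h E = card {S \<in> copies F {1..n}. S \<subseteq> E}" for E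
    have pos: "0 \<le> B ^ e" "0 \<le> 2 * (\<mu>\<^sup>2 * real (v ^ v)) / \<eta>" using B \<mu> \<eta> by auto
    have big: "v \<le> n" "B ^ e \<le> real n" "2 * (\<mu>\<^sup>2 * real (v ^ v)) / \<eta> \<le> real n" "0 < real n"
      using n n0 pos by linarith+
    have err: "2 * (\<mu>\<^sup>2 * 2 ^ e * real (v ^ (2 * v)) / B) + \<mu>\<^sup>2 * real (v ^ v) / n \<le> \<eta>"
    proof -
      have "\<mu>\<^sup>2 * 2 ^ e * real (v ^ (2 * v)) / B = \<eta> / 4" using \<mu> \<eta> v by (simp add: B_def)
      moreover have "\<mu>\<^sup>2 * real (v ^ v) / n \<le> \<eta> / 2" using big(3,4) \<eta> by (simp add: field_simps)
      ultimately show ?thesis by linarith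
    qed
    have rec: "\<bar>real (Suc j) * measure_pmf.prob D {E. h E = Suc j} - \<mu> * measure_pmf.prob D {E. h E = j}\<bar> \<le> \<eta>" for j
    proof -
      have "\<bar>real (Suc j) * measure_pmf.prob D {E. h E = Suc j} - card (copies F {1..n}) * p ^ e * measure_pmf.prob D {E. h E = j}\<bar>
        \<le> (\<Sum>S\<in>copies F {1..n}. \<Sum>T\<in>{T \<in> copies F {1..n}. T \<noteq> S \<and> T \<inter> S \<noteq> {}}. p ^ card (S \<union> T)) +
        (\<Sum>S\<in>copies F {1..n}. \<Sum>T\<in>{T \<in> copies F {1..n}. T \<inter> S \<noteq> {}}. p ^ (2 * e))"
        unfolding D_def h_def
      proof (rule count_recursion)
        show "finite (vertex_pairs {1..n})" by (simp add: finite_vertex_pairs)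
        show "finite (copies F {1..n})" by (simp add: finite_copies)
        show "S \<subseteq> vertex_pairs {1..n}" if "S \<in> copies F {1..n}" for S
          using copies_subset_vertex_pairs[OF that F'(3)] .
        show "card S = e" if "S \<in> copies F {1..n}" for S using copies_card(1)[OF that] by (simp add: e_def)
      qed (use e p in auto)
      also have "\<dots> \<le> 2 * (\<mu>\<^sup>2 * 2 ^ e * real (v ^ (2 * v)) / B) + \<mu>\<^sup>2 * real (v ^ v) / n"
        using recursion_error_le[OF F, of "{1..n}" \<mu> p B] big \<mu> p B by (simp add: v_def e_def)
      finally show ?thesis using err p(3) by (simp add: e_def)
    qed
    have eq: "measure_pmf.prob D {E. h E = j} = pmf (map_pmf h D) j" for j
      by (simp add: pmf_map vimage_def)
    have "measure_pmf.prob D {E. h E = m} \<le> \<epsilon>"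
    proof (rule anti)
      show "sum (\<lambda>j. measure_pmf.prob D {E. h E = j}) I \<le> 1" if "finite I" for I
        unfolding eq by (subst measure_measure_pmf_finite[OF that, symmetric]) (rule measure_pmf.prob_le_1)
    qed (use rec in auto)
    then show ?thesis
      unfolding prob_random_graph_count_copies[of n p "\<lambda>x. x = m"] D_def h_def .
  qed
  then show thesis using that \<mu> by blast
qed

text \<open>Given the first sample, a collision means that the second hits one prescribed value, so
  the bound on atoms survives averaging.\<close>

lemma prob_pair_pmf_collision_le:
  fixes h :: "'a \<Rightarrow> 'b"
  assumes "\<And>m. measure_pmf.prob M {x. h x = m} \<le> \<epsilon>"
  shows "measure_pmf.prob (pair_pmf N M) {(x, y). h x = h y} \<le> \<epsilon>"
proof -
  have "measure_pmf.prob (pair_pmf N M) {(x, y). h x = h y} =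
      pmf (map_pmf (\<lambda>(x, y). h x = h y) (pair_pmf N M)) True"
    unfolding pmf_map by (rule arg_cong[where f = "measure_pmf.prob _"]) auto
  also have "map_pmf (\<lambda>(x, y). h x = h y) (pair_pmf N M) = bind_pmf N (\<lambda>x. map_pmf (\<lambda>y. h x = h y) M)"
    by (simp add: pair_pmf_def map_bind_pmf map_pmf_def bind_assoc_pmf bind_return_pmf)
  also have "pmf \<dots> True = (LINT x|measure_pmf N. pmf (map_pmf (\<lambda>y. h x = h y) M) True)"
    by (rule pmf_bind)
  also have "\<dots> \<le> (LINT x|measure_pmf N. \<epsilon>)"
  proof (rule integral_mono)
    show "integrable (measure_pmf N) (\<lambda>x. pmf (map_pmf (\<lambda>y. h x = h y) M) True)"
      by (rule measure_pmf.integrable_const_bound[where B = 1]) (auto simp: pmf_le_1)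
    show "pmf (map_pmf (\<lambda>y. h x = h y) M) True \<le> \<epsilon>" for x
      using assms[of "h x"] by (simp add: pmf_map vimage_def eq_commute)
  qed simp
  also have "\<dots> = \<epsilon>" by simp
  finally show ?thesis .
qed

lemma prob_pair_pmf_fst: "measure_pmf.prob (pair_pmf M N) {(x, y). P x} = measure_pmf.prob M {x. P x}"
proof -
  have "measure_pmf.prob M {x. P x} = measure_pmf.prob (map_pmf fst (pair_pmf M N)) {x. P x}"
    by (simp add: map_fst_pair_pmf)
  also have "\<dots> = measure_pmf.prob (pair_pmf M N) {(x, y). P x}"
    by (simp add: vimage_def case_prod_unfold)
  finally show ?thesis ..
qed

text \<open>Half of \<open>\<epsilon>\<close> pays for equal counts, the other half for a first
  count of at least \<open>M\<close>, by Markov's inequality with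
  \<open>M > 2 * \<mu> / \<epsilon>\<close>. Outside both events depth \<open>M * b\<close>
  suffices, and neither factor depends on \<open>n\<close>.\<close>

lemma prob_distinguishability_ge:
  fixes F :: "nat set set" and \<epsilon> :: real
  assumes F: "strictly_balanced F" and \<epsilon>: "0 < \<epsilon>"
  obtains \<mu> :: real and n\<^sub>0 k :: nat where "1 \<le> \<mu>"
    "\<And>n p. n\<^sub>0 \<le> n \<Longrightarrow> 0 < p \<Longrightarrow> p \<le> 1 \<Longrightarrow> real (card (copies F {1..n})) * p ^ card F = \<mu> \<Longrightarrow>
      1 - \<epsilon> \<le> measure_pmf.prob (pair_pmf (random_graph n p) (random_graph n p))
        {(G\<^sub>1, G\<^sub>2). fo_distinguishability G\<^sub>1 G\<^sub>2 \<le> enat k}"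
proof -
  have F': "finite F" "F \<noteq> {}" "\<forall>e\<in>F. card e = 2" using F by (auto simp: strictly_balanced_def)
  have finU: "finite (\<Union>F)" using F' finite_Union_card2 by blast
  then obtain b where b: "\<Union>F \<subseteq> {..<b}" using finite_nat_iff_bounded by blast
  have "0 < \<epsilon> / 2" using \<epsilon> by simp
  then obtain \<mu> n\<^sub>0 where \<mu>: "1 \<le> \<mu>" and anti:
    "\<And>n p m. n\<^sub>0 \<le> n \<Longrightarrow> 0 < p \<Longrightarrow> p \<le> 1 \<Longrightarrow> real (card (copies F {1..n})) * p ^ card F = \<mu> \<Longrightarrow>
      measure_pmf.prob (random_graph n p) {G. count_copies F G = m} \<le> \<epsilon> / 2"
    using count_copies_anticoncentration[OF F] by metis
  obtain M :: nat where M: "2 * \<mu> / \<epsilon> < M" using reals_Archimedean2 by blast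
  have "0 < 2 * \<mu> / \<epsilon>" using \<mu> \<epsilon> by simp
  then have M0: "0 < real M" using M by linarith
  have "1 - \<epsilon> \<le> measure_pmf.prob (pair_pmf (random_graph n p) (random_graph n p))
        {(G\<^sub>1, G\<^sub>2). fo_distinguishability G\<^sub>1 G\<^sub>2 \<le> enat (M * b)}"
    if n: "n\<^sub>0 \<le> n" and p: "0 < p" "p \<le> 1" "real (card (copies F {1..n})) * p ^ card F = \<mu>" for n p
  proof -
    let ?R = "random_graph n p" and ?P = "measure_pmf.prob (pair_pmf (random_graph n p) (random_graph n p))"
    let ?good = "{(G\<^sub>1, G\<^sub>2). fo_distinguishability G\<^sub>1 G\<^sub>2 \<le> enat (M * b)} :: (nat graph \<times> nat graph) set"
    let ?same = "{(G\<^sub>1, G\<^sub>2). count_copies F G\<^sub>1 = count_copies F G\<^sub>2} :: (nat graph \<times> nat graph) set"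
    let ?many = "{(G\<^sub>1, G\<^sub>2). M \<le> count_copies F G\<^sub>1} :: (nat graph \<times> nat graph) set"
    have "?P ?same \<le> \<epsilon> / 2" using anti[OF n p] by (rule prob_pair_pmf_collision_le)
    moreover have "?P ?many \<le> \<epsilon> / 2"
    proof -
      have "?P ?many = measure_pmf.prob ?R {G. M \<le> count_copies F G}" by (rule prob_pair_pmf_fst)
      also have "\<dots> = measure_pmf.prob (random_subset (vertex_pairs {1..n}) p)
          {E. M \<le> card {S \<in> copies F {1..n}. S \<subseteq> E}}"
        by (rule prob_random_graph_count_copies)
      also have "\<dots> \<le> card (copies F {1..n}) * p ^ card F / M"
      proof (rule prob_count_ge_le)
        show "finite (vertex_pairs {1..n})" by (simp add: finite_vertex_pairs)
        show "finite (copies F {1..n})" by (simp add: finite_copies)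
        show "S \<subseteq> vertex_pairs {1..n}" if "S \<in> copies F {1..n}" for S
          using copies_subset_vertex_pairs[OF that F'(3)] .
      qed (use p M0 copies_card(1) in auto)
      also have "\<dots> \<le> \<epsilon> / 2" unfolding p(3) using M M0 \<epsilon> by (simp add: field_simps)
      finally show ?thesis .
    qed
    moreover have "1 \<le> ?P ?good + ?P ?same + ?P ?many"
    proof -
      have supp: "finite (verts G)" if "G \<in> set_pmf ?R" for G
        using simple_graph_random_graph[OF that] by (simp add: simple_graph_def)
      have "x \<in> ?good \<union> ?same \<union> ?many" if "x \<in> set_pmf (pair_pmf ?R ?R)" for x
      proof -
        obtain G\<^sub>1 G\<^sub>2 where x: "x = (G\<^sub>1, G\<^sub>2)" by (cases x)
        then have "finite (verts G\<^sub>1)" "finite (verts G\<^sub>2)" using that supp by auto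
        then show ?thesis using fo_distinguishability_le[OF F' b, of G\<^sub>1 G\<^sub>2 M] unfolding x
          by (cases "count_copies F G\<^sub>1 = count_copies F G\<^sub>2") (auto simp: not_le)
      qed
      then have "?P (?good \<union> ?same \<union> ?many) = 1"
        by (subst measure_pmf.prob_eq_1) (auto simp: AE_measure_pmf_iff)
      moreover have "?P (?good \<union> ?same \<union> ?many) \<le> ?P (?good \<union> ?same) + ?P ?many" by (rule measure_Un_le) auto
      moreover have "?P (?good \<union> ?same) \<le> ?P ?good + ?P ?same" by (rule measure_Un_le) auto
      ultimately show ?thesis by linarith
    qed
    ultimately show ?thesis by linarith
  qed
  then show thesis using that \<mu> by blast
qed

section \<open>Choice of the exponent\<close>

text \<open>With \<open>N\<close> the number of potential copies, the exponent is
  \<open>(ln N - ln \<mu>) / (e * ln n)\<close>, and \<open>(n / v) ^ v \<le> N \<le> n ^ v\<close>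
  drives it to \<open>v / e\<close>. The first threshold on \<open>n\<close> lets
  \<open>ln n\<close> outweigh the constants in \<open>a < \<alpha>\<close>; the second gives
  \<open>\<mu> \<le> N\<close>, so that the edge probability is at most 1.\<close>

lemma exponent_for_mean:
  fixes F :: "nat set set" and a b \<mu> :: real
  assumes F: "strictly_balanced F" and \<mu>: "1 \<le> \<mu>"
    and a: "a * card F < card (\<Union>F)" and b: "card (\<Union>F) < b * card F"
  shows "\<forall>\<^sub>F n in sequentially. \<exists>\<alpha>. a < \<alpha> \<and> \<alpha> < b \<and> real n powr - \<alpha> \<le> 1 \<and>
    real (card (copies F {1..n})) * (real n powr - \<alpha>) ^ card F = \<mu>"
proof -
  define v where "v = card (\<Union>F)"
  define e where "e = card F"
  have F': "finite F" "F \<noteq> {}" "\<forall>e\<in>F. card e = 2" using F by (auto simp: strictly_balanced_def)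
  have finU: "finite (\<Union>F)" using F' finite_Union_card2 by blast
  have "\<Union>F \<noteq> {}" using F' by fastforce
  then have v: "0 < v" using finU by (simp add: v_def card_gt_0_iff)
  have e: "0 < e" using F' by (simp add: e_def card_gt_0_iff)
  have gap: "0 < v - a * e" using a by (simp add: v_def e_def)
  have "\<forall>\<^sub>F n in sequentially. (v * ln v + ln \<mu>) / (v - a * e) < ln (real n)"
    using filterlim_compose[OF ln_at_top filterlim_real_sequentially] by (simp add: filterlim_at_top_dense)
  moreover have "\<forall>\<^sub>F n in sequentially. v ^ v * \<mu> \<le> real n"
    using filterlim_real_sequentially by (simp add: filterlim_at_top)
  ultimately show ?thesis
    using eventually_ge_at_top[of 2] eventually_ge_at_top[of v]
  proof eventually_elim
    case (elim n)
    define N where "N = real (card (copies F {1..n}))"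
    have n: "1 < real n" "0 < ln (real n)" using elim(3) by auto
    have lower: "real n ^ v \<le> v ^ v * N"
      using card_copies_ge[of "{1..n}" F] finU elim(4) v by (simp add: v_def N_def)
    have "real n \<le> real n ^ v" using n v by (intro self_le_power) auto
    then have "real (v ^ v) * \<mu> \<le> v ^ v * N"
      using order_trans[OF order_trans[OF elim(2)] lower] by simp
    then have N\<mu>: "\<mu> \<le> N" using v by simp
    then have N: "0 < N" using \<mu> by simp
    have "card (copies F {1..n}) \<le> n ^ v"
      using card_copies_le[of "{1..n}" F] finU by (simp add: v_def)
    then have upper: "N \<le> real n ^ v" unfolding N_def by (metis of_nat_le_iff of_nat_power)
    define l where "l = (ln \<mu> - ln N) / e"
    define \<alpha> where "\<alpha> = - l / ln n"
    have p: "real n powr - \<alpha> = exp l" using n by (simp add: powr_def \<alpha>_def)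
    have "exp l ^ e = \<mu> / N"
      using e \<mu> N by (simp add: l_def exp_of_nat_mult[symmetric] exp_diff)
    then have "N * (real n powr - \<alpha>) ^ card F = \<mu>" unfolding p using N by (simp add: e_def)
    moreover have "ln \<mu> \<le> ln N" using N\<mu> \<mu> by simp
    then have "l \<le> 0" using e by (simp add: l_def divide_nonpos_pos)
    then have "real n powr - \<alpha> \<le> 1" unfolding p by simp
    moreover have "a < \<alpha>"
    proof -
      have "ln (real n ^ v) \<le> ln (v ^ v * N)" using lower n N v by (subst ln_le_cancel_iff) auto
      then have "v * ln n - v * ln v \<le> ln N" using n N v by (simp add: ln_mult ln_realpow)
      moreover have "v * ln v + ln \<mu> < (v - a * e) * ln n"
        using elim(1) gap by (simp add: divide_less_eq mult.commute)
      ultimately have "a * ln n * e < ln N - ln \<mu>" by (simp add: algebra_simps)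
      then have "a * ln n < (ln N - ln \<mu>) / e" using e by (simp add: pos_less_divide_eq)
      then have "a * ln n < - l" by (simp add: l_def minus_divide_left)
      then show ?thesis unfolding \<alpha>_def pos_less_divide_eq[OF n(2)] .
    qed
    moreover have "\<alpha> < b"
    proof -
      have "ln N \<le> ln (real n ^ v)" using upper n N by (subst ln_le_cancel_iff) auto
      then have "ln N \<le> v * ln n" using n by (simp add: ln_realpow)
      moreover have "v * ln n < b * e * ln n"
        using b n by (intro mult_strict_right_mono) (auto simp: v_def e_def)
      moreover have "0 \<le> ln \<mu>" using \<mu> by simp
      ultimately have "ln N - ln \<mu> < b * ln n * e" by (simp add: mult_ac)
      then have "(ln N - ln \<mu>) / e < b * ln n" using e by (simp add: pos_divide_less_eq)
      then have "- l < b * ln n" by (simp add: l_def minus_divide_left)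
      then show ?thesis unfolding \<alpha>_def pos_divide_less_eq[OF n(2)] .
    qed
    ultimately show ?case by (intro exI[of _ \<alpha>]) (simp add: N_def)
  qed
qed

text \<open>Exponents between \<open>a\<close> and \<open>b\<close> correspond to densities between
  \<open>1 / b\<close> and \<open>1 / a\<close>, which lie in the range from 1 to 5/4. The exponent
  may move with \<open>n\<close>, but the depth \<open>k\<close> may not.\<close>

lemma distinguishable_near:
  fixes a b \<epsilon> :: real
  assumes ab: "4 / 5 \<le> a" "a < b" "b \<le> 1" and \<epsilon>: "0 < \<epsilon>"
  obtains k :: nat where "\<forall>\<^sub>F n in sequentially. \<exists>\<alpha>. a < \<alpha> \<and> \<alpha> < b \<and>
    1 - \<epsilon> \<le> measure_pmf.prob (pair_pmf (random_graph n (real n powr - \<alpha>)) (random_graph n (real n powr - \<alpha>)))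
      {(G\<^sub>1, G\<^sub>2). fo_distinguishability G\<^sub>1 G\<^sub>2 \<le> enat k}"
proof -
  have "1 \<le> 1 / b" "1 / b < 1 / a" "1 / a \<le> 5 / 4" using ab by (auto simp: field_simps)
  then obtain F :: "nat set set" where F: "strictly_balanced F"
    "1 / b * card (\<Union>F) < card F" "card F < 1 / a * card (\<Union>F)"
    using exists_strictly_balanced by metis
  have aF: "a * card F < card (\<Union>F)" "card (\<Union>F) < b * card F"
    using F(2,3) ab by (auto simp: field_simps)
  obtain \<mu> n\<^sub>0 k where \<mu>: "1 \<le> \<mu>" and dist:
    "\<And>n p. n\<^sub>0 \<le> n \<Longrightarrow> 0 < p \<Longrightarrow> p \<le> 1 \<Longrightarrow> real (card (copies F {1..n})) * p ^ card F = \<mu> \<Longrightarrow>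
      1 - \<epsilon> \<le> measure_pmf.prob (pair_pmf (random_graph n p) (random_graph n p))
        {(G\<^sub>1, G\<^sub>2). fo_distinguishability G\<^sub>1 G\<^sub>2 \<le> enat k}"
    using prob_distinguishability_ge[OF F(1) \<epsilon>] by metis
  have "\<forall>\<^sub>F n in sequentially. \<exists>\<alpha>. a < \<alpha> \<and> \<alpha> < b \<and>
    1 - \<epsilon> \<le> measure_pmf.prob (pair_pmf (random_graph n (real n powr - \<alpha>)) (random_graph n (real n powr - \<alpha>)))
      {(G\<^sub>1, G\<^sub>2). fo_distinguishability G\<^sub>1 G\<^sub>2 \<le> enat k}"
    using exponent_for_mean[OF F(1) \<mu> aF] eventually_ge_at_top[of n\<^sub>0] eventually_ge_at_top[of 1]
  proof eventually_elim
    case (elim n)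
    then obtain \<alpha> where \<alpha>: "a < \<alpha>" "\<alpha> < b" "real n powr - \<alpha> \<le> 1"
      "real (card (copies F {1..n})) * (real n powr - \<alpha>) ^ card F = \<mu>" by blast
    have "0 < real n powr - \<alpha>" using elim(3) by simp
    then show ?case using dist[OF elim(2) _ \<alpha>(3,4)] \<alpha>(1,2) by blast
  qed
  then show thesis using that by blast
qed

text \<open>The probability is a finite sum of polynomials in the edge probability. For positive
  \<open>\<alpha>\<close> this probability stays in the unit interval, where the product formula for
  \<open>random_subset\<close> is valid.\<close>

lemma continuous_on_prob_random_graph_pair:
  fixes n :: nat and X :: "(nat graph \<times> nat graph) set"
  assumes n: "1 \<le> n"
  shows "continuous_on {0<..} (\<lambda>\<alpha>. measure_pmf.prob
    (pair_pmf (random_graph n (real n powr - \<alpha>)) (random_graph n (real n powr - \<alpha>))) X)"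
proof -
  define A where "A = vertex_pairs {1..n}"
  have finA: "finite A" by (simp add: A_def finite_vertex_pairs)
  define g where "g E = \<lparr>verts = {1..n}, edges = E\<rparr>" for E
  define w where "w p E = (\<Prod>x\<in>A. if x \<in> E then p else 1 - p)" for p :: real and E
  have eq: "measure_pmf.prob (pair_pmf (random_graph n p) (random_graph n p)) X =
      (\<Sum>(E\<^sub>1, E\<^sub>2)\<in>Pow A \<times> Pow A. w p E\<^sub>1 * w p E\<^sub>2 * of_bool ((g E\<^sub>1, g E\<^sub>2) \<in> X))"
    if p: "0 \<le> p" "p \<le> 1" for p
  proof -
    let ?D = "random_subset A p"
    let ?Y = "(\<lambda>(E\<^sub>1, E\<^sub>2). (g E\<^sub>1, g E\<^sub>2)) -` X"
    have "pair_pmf (random_graph n p) (random_graph n p) =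
        map_pmf (\<lambda>(E\<^sub>1, E\<^sub>2). (g E\<^sub>1, g E\<^sub>2)) (pair_pmf ?D ?D)"
      unfolding random_graph_eq_map_random_subset A_def[symmetric] g_def[symmetric] by (rule map_pair[symmetric])
    then have "measure_pmf.prob (pair_pmf (random_graph n p) (random_graph n p)) X = measure_pmf.prob (pair_pmf ?D ?D) ?Y"
      by simp
    also have "\<dots> = measure_pmf.prob (pair_pmf ?D ?D) (?Y \<inter> (Pow A \<times> Pow A))"
      by (subst (1 2) measure_Int_set_pmf[symmetric], rule arg_cong[where f = "measure_pmf.prob _"])
        (use set_random_subset[of A p] in auto)
    also have "\<dots> = (\<Sum>x\<in>?Y \<inter> (Pow A \<times> Pow A). pmf (pair_pmf ?D ?D) x)"
      using finA by (intro measure_measure_pmf_finite) auto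
    also have "\<dots> = (\<Sum>(E\<^sub>1, E\<^sub>2)\<in>Pow A \<times> Pow A. w p E\<^sub>1 * w p E\<^sub>2 * of_bool ((g E\<^sub>1, g E\<^sub>2) \<in> X))"
      using finA p by (intro sum.mono_neutral_cong_left) (auto simp: pmf_pair pmf_random_subset w_def)
    finally show ?thesis .
  qed
  have "continuous_on {0<..} (\<lambda>\<alpha>. \<Sum>(E\<^sub>1, E\<^sub>2)\<in>Pow A \<times> Pow A.
      w (real n powr - \<alpha>) E\<^sub>1 * w (real n powr - \<alpha>) E\<^sub>2 * of_bool ((g E\<^sub>1, g E\<^sub>2) \<in> X))"
  proof -
    have pw: "continuous_on {0<..} (\<lambda>\<alpha>. real n powr - \<alpha>)" using n by (intro continuous_intros) auto
    have "continuous_on {0<..} (\<lambda>\<alpha>. w (real n powr - \<alpha>) E)" for E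
      unfolding w_def
    proof (rule continuous_on_prod)
      fix x
      show "continuous_on {0<..} (\<lambda>\<alpha>. if x \<in> E then real n powr - \<alpha> else 1 - real n powr - \<alpha>)"
        using pw by (cases "x \<in> E") (auto intro!: continuous_intros)
    qed
    then show ?thesis by (auto simp: case_prod_unfold intro!: continuous_intros)
  qed
  moreover have "real n powr - \<alpha> \<le> 1" if "\<alpha> \<in> {0<..}" for \<alpha>
    using n that powr_mono[of "- \<alpha>" 0 "real n"] by auto
  ultimately show ?thesis by (subst continuous_on_cong[OF refl eq]) auto
qed

theorem theorem3:
  fixes f :: "nat \<Rightarrow> real"
  assumes "filterlim f at_top sequentially"
  shows "\<exists>(\<alpha>::real) (n :: nat \<Rightarrow> nat).
           \<alpha> \<notin> \<rat> \<and> 0 < \<alpha> \<and> \<alpha> < 1 \<and> strict_mono n \<and> (\<forall>t. 0 < n t) \<and>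
           (\<lambda>t. measure_pmf.prob
                  (pair_pmf (random_graph (n t) (real (n t) powr - \<alpha>))
                            (random_graph (n t) (real (n t) powr - \<alpha>)))
                  {(G\<^sub>1, G\<^sub>2). ereal_of_enat (fo_distinguishability G\<^sub>1 G\<^sub>2) \<le> ereal (f (n t))})
             \<longlonglongrightarrow> 1"
proof -
  define X :: "nat \<Rightarrow> (nat graph \<times> nat graph) set" where
    "X n = {(G\<^sub>1, G\<^sub>2). ereal_of_enat (fo_distinguishability G\<^sub>1 G\<^sub>2) \<le> ereal (f n)}" for n
  define P where "P n \<alpha> = measure_pmf.prob
    (pair_pmf (random_graph n (real n powr - \<alpha>)) (random_graph n (real n powr - \<alpha>))) (X n)" for n \<alpha>
  define I :: "real set" where "I = {4 / 5<..<1}"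
  \<comment> \<open>The restriction to \<open>n > t\<close> is what makes a point of all
    \<open>U t\<close> good for infinitely many \<open>n\<close>, with failure probability tending
    to 0.\<close>
  define U where "U t = (\<Union>n\<in>{Suc t..}. {\<alpha> \<in> I. 1 - 1 / Suc t < P n \<alpha>})" for t :: nat
  have openU: "open (U t)" for t
    unfolding U_def
  proof (intro open_UN ballI)
    fix n assume "n \<in> {Suc t..}"
    then have "continuous_on I (P n)"
      unfolding P_def by (intro continuous_on_subset[OF continuous_on_prob_random_graph_pair]) (auto simp: I_def)
    then have "open (P n -` {1 - 1 / Suc t<..} \<inter> I)"
      by (intro continuous_on_open_vimage[THEN iffD1, rule_format]) (auto simp: I_def)
    also have "P n -` {1 - 1 / Suc t<..} \<inter> I = {\<alpha> \<in> I. 1 - 1 / Suc t < P n \<alpha>}" by auto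
    finally show "open {\<alpha> \<in> I. 1 - 1 / Suc t < P n \<alpha>}" .
  qed
  have denseU: "\<exists>\<alpha>\<in>U t. a < \<alpha> \<and> \<alpha> < b" if ab: "4 / 5 \<le> a" "a < b" "b \<le> 1" for a b t
  proof -
    \<comment> \<open>Half of the allowed error turns the weak inequality of
      \<open>distinguishable_near\<close> into the strict one that defines
      \<open>U t\<close>.\<close>
    have pos: "0 < 1 / (2 * real (Suc t))" by simp
    obtain k where k: "\<forall>\<^sub>F n in sequentially. \<exists>\<alpha>. a < \<alpha> \<and> \<alpha> < b \<and>
      1 - 1 / (2 * real (Suc t)) \<le> measure_pmf.prob (pair_pmf (random_graph n (real n powr - \<alpha>)) (random_graph n (real n powr - \<alpha>)))
        {(G\<^sub>1, G\<^sub>2). fo_distinguishability G\<^sub>1 G\<^sub>2 \<le> enat k}"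
      by (rule distinguishable_near[OF ab pos])
    have "\<forall>\<^sub>F n in sequentially. real k \<le> f n" using assms by (simp add: filterlim_at_top)
    with k have "\<forall>\<^sub>F n in sequentially. Suc t \<le> n \<and> real k \<le> f n \<and> (\<exists>\<alpha>. a < \<alpha> \<and> \<alpha> < b \<and>
      1 - 1 / (2 * real (Suc t)) \<le> measure_pmf.prob (pair_pmf (random_graph n (real n powr - \<alpha>)) (random_graph n (real n powr - \<alpha>)))
        {(G\<^sub>1, G\<^sub>2). fo_distinguishability G\<^sub>1 G\<^sub>2 \<le> enat k})"
      using eventually_ge_at_top[of "Suc t"] by eventually_elim blast
    then obtain n \<alpha> where n: "Suc t \<le> n" "real k \<le> f n" and \<alpha>: "a < \<alpha>" "\<alpha> < b"
      and pr: "1 - 1 / (2 * real (Suc t)) \<le> measure_pmf.prob (pair_pmf (random_graph n (real n powr - \<alpha>)) (random_graph n (real n powr - \<alpha>)))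
        {(G\<^sub>1, G\<^sub>2). fo_distinguishability G\<^sub>1 G\<^sub>2 \<le> enat k}"
      using eventually_happens'[OF sequentially_bot] by blast
    have "{(G\<^sub>1, G\<^sub>2). fo_distinguishability G\<^sub>1 G\<^sub>2 \<le> enat k} \<subseteq> X n"
    proof (clarify)
      fix G\<^sub>1 G\<^sub>2 :: "nat graph" assume "fo_distinguishability G\<^sub>1 G\<^sub>2 \<le> enat k"
      then have "ereal_of_enat (fo_distinguishability G\<^sub>1 G\<^sub>2) \<le> ereal_of_enat (enat k)"
        by (simp only: ereal_of_enat_le_iff)
      also have "\<dots> \<le> ereal (f n)" using n(2) by simp
      finally show "(G\<^sub>1, G\<^sub>2) \<in> X n" by (simp add: X_def)
    qed
    then have "1 - 1 / (2 * real (Suc t)) \<le> P n \<alpha>"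
      unfolding P_def by (intro order_trans[OF pr] measure_pmf.finite_measure_mono) auto
    moreover have "1 - 1 / real (Suc t) < 1 - 1 / (2 * real (Suc t))" by (simp add: field_simps)
    ultimately have "1 - 1 / Suc t < P n \<alpha>" by linarith
    then have "\<alpha> \<in> U t" using n(1) \<alpha> ab by (auto simp: U_def I_def)
    then show ?thesis using \<alpha> by blast
  qed
  \<comment> \<open>The sets \<open>I - {q}\<close> are open and dense too; they make every point of
    the intersection irrational.\<close>
  define \<G> where "\<G> = range U \<union> (\<lambda>q. I - {q}) ` \<rat>"
  \<comment> \<open>Baire's theorem is applied in the closed interval, which is complete. The
    members of \<open>\<G>\<close> are open in the reals and contained in it, hence relatively
    open.\<close>
  have "{4 / 5..1} \<subseteq> closure (\<Inter>\<G>)"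
  proof (rule Baire)
    show "countable \<G>" unfolding \<G>_def using countable_rat by auto
    fix T assume T: "T \<in> \<G>"
    have "open T" using T openU by (auto simp: \<G>_def I_def)
    have "T \<subseteq> {4 / 5..1}" using T by (auto simp: \<G>_def U_def I_def)
    have denseT: "\<exists>\<alpha>\<in>T. a < \<alpha> \<and> \<alpha> < b" if ab: "4 / 5 \<le> a" "a < b" "b \<le> 1" for a b
    proof (cases "T \<in> range U")
      case True
      then show ?thesis using denseU[OF ab] by auto
    next
      case False
      then obtain q where "T = I - {q}" using T by (auto simp: \<G>_def)
      moreover obtain c d where "a < c" "c < d" "d < b" using dense ab(2) by meson
      ultimately show ?thesis using ab by (cases "c = q") (auto simp: I_def intro: bexI[of _ c] bexI[of _ d])
    qed
    have "{4 / 5<..<1} \<subseteq> closure T"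
    proof
      fix x :: real assume x: "x \<in> {4 / 5<..<1}"
      show "x \<in> closure T"
        unfolding closure_approachable
      proof (intro allI impI)
        fix \<delta> :: real assume "0 < \<delta>"
        then obtain \<alpha> where "\<alpha> \<in> T" "x < \<alpha>" "\<alpha> < min 1 (x + \<delta>)"
          using denseT[of x "min 1 (x + \<delta>)"] x by auto
        then show "\<exists>y\<in>T. dist y x < \<delta>" by (auto simp: dist_real_def intro!: bexI[of _ \<alpha>])
      qed
    qed
    then have "closure {4 / 5<..<1} \<subseteq> closure T" by (rule closure_minimal) simp
    then show "openin (top_of_set {4 / 5..1}) T \<and> {4 / 5..1} \<subseteq> closure T"
      using \<open>open T\<close> \<open>T \<subseteq> {4 / 5..1}\<close> by (simp add: open_subset)
  qed simp
  then have "\<Inter>\<G> \<noteq> {}" by auto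
  then obtain \<alpha> where \<alpha>: "\<alpha> \<in> \<Inter>\<G>" by blast
  have irr: "\<alpha> \<notin> \<rat>" using \<alpha> by (auto simp: \<G>_def)
  have inU: "\<alpha> \<in> U t" for t using \<alpha> by (auto simp: \<G>_def)
  have I: "0 < \<alpha>" "\<alpha> < 1" using inU[of 0] by (auto simp: U_def I_def)
  have ex: "\<exists>n\<ge>Suc t. 1 - 1 / Suc t < P n \<alpha>" for t using inU[of t] by (auto simp: U_def)
  have "\<exists>n. \<forall>t. (0 < n t \<and> 1 - 1 / Suc t < P (n t) \<alpha>) \<and> n t < n (Suc t)"
  proof (rule dependent_nat_choice)
    show "\<exists>n>0. 1 - 1 / Suc 0 < P n \<alpha>" using ex[of 0] by (auto simp: Suc_le_eq)
  next
    fix m t assume "0 < m \<and> 1 - 1 / Suc t < P m \<alpha>"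
    \<comment> \<open>An index of at least \<open>m\<close> forces \<open>m < n\<close>, and one of
      at least \<open>Suc t\<close> keeps the required error bound.\<close>
    obtain n where n: "Suc (max m (Suc t)) \<le> n" "1 - 1 / Suc (max m (Suc t)) < P n \<alpha>" using ex by blast
    have "1 / real (Suc (max m (Suc t))) \<le> 1 / real (Suc (Suc t))" by (intro divide_left_mono) auto
    then have "1 - 1 / Suc (Suc t) < P n \<alpha>" using n(2) by linarith
    then show "\<exists>n. (0 < n \<and> 1 - 1 / Suc (Suc t) < P n \<alpha>) \<and> m < n" using n(1) by (intro exI[of _ n]) auto
  qed
  then obtain n where n: "\<And>t. 0 < n t" "\<And>t. 1 - 1 / Suc t < P (n t) \<alpha>" "\<And>t. n t < n (Suc t)" by blast
  have "(\<lambda>t. P (n t) \<alpha>) \<longlonglongrightarrow> 1"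
  proof (rule tendsto_sandwich)
    show "(\<lambda>t. 1 - 1 / real (Suc t)) \<longlonglongrightarrow> 1"
      using tendsto_diff[OF tendsto_const[of 1] LIMSEQ_inverse_real_of_nat] by (simp add: inverse_eq_divide)
    show "\<forall>\<^sub>F t in sequentially. 1 - 1 / real (Suc t) \<le> P (n t) \<alpha>" using n(2) by (simp add: less_imp_le)
    show "\<forall>\<^sub>F t in sequentially. P (n t) \<alpha> \<le> 1" by (simp add: P_def measure_pmf.prob_le_1)
  qed simp
  then show ?thesis
    unfolding P_def X_def using irr I n(1,3) by (intro exI[of _ \<alpha>] exI[of _ n]) (auto simp: strict_mono_Suc_iff)
qed

end
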